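(* Let $\Omega\subseteq\mathbb{C}$ be a connected open set and $n$ a positive integer. If an operator $T$ is in $\mathcal{F}B_n(\Omega)$, then $T$ is irreducible, i.e. the only orthogonal projections commuting with $T$ are $0$ and $I$.
   Context: All Hilbert spaces are complex and separable and all operators are bounded and linear. For a connected open set $\Omega\subseteq\mathbb{C}$ and a positive integer $n$, $B_n(\Omega)$ (the Cowen-Douglas class) is the set of bounded operators $T$ on a Hilbert space $\mathcal{H}$ such that $\Omega\subset\sigma(T)$; $\mathrm{ran}(T-w)=\mathcal{H}$ for all $w\in\Omega$; the closed linear span of $\bigcup_{w\in\Omega}\ker(T-w)$ is $\mathcal{H}$; and $\dim\ker(T-w)=n$ for all $w\in\Omega$. $\mathcal{F}B_n(\Omega)$ is the set of bounded operators $T$ on a Hilbert space given as an orthogonal direct sum $\mathcal{H}=\mathcal{H}_0\oplus\cdots\oplus\mathcal{H}_{n-1}$ whose block matrix is upper triangular, with diagonal entries $T_i:\mathcal{H}_i\to\mathcal{H}_i$ in $B_1(\Omega)$ ($0\le i\le n-1$), entries $S_{i,j}:\mathcal{H}_j\to\mathcal{H}_i$ in position $(i,j)$ for $i<j$, and zero entries below the diagonal, where each $S_{i,i+1}$ is non-zero and $T_iS_{i,i+1}=S_{i,i+1}T_{i+1}$ for $0\le i\le n-2$. *)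

theory Defs
  imports "HOL-Analysis.Analysis"
begin

class scaleC =
  fixes scaleC :: "complex \<Rightarrow> 'a \<Rightarrow> 'a"  (infixr \<open>*\<^sub>C\<close> 75)

text \<open>
  Every complex inner product space is a real one under the real part of its inner product; norm
  and topology are inherited from there. The inner product is linear in its first argument.
\<close>

class complex_inner = real_inner + scaleC +
  fixes cinner :: "'a \<Rightarrow> 'a \<Rightarrow> complex"
  assumes scaleC_add_right: "a *\<^sub>C (x + y) = a *\<^sub>C x + a *\<^sub>C y"
    and scaleC_add_left: "(a + b) *\<^sub>C x = a *\<^sub>C x + b *\<^sub>C x"
    and scaleC_scaleC: "a *\<^sub>C (b *\<^sub>C x) = (a * b) *\<^sub>C x"
    and scaleC_one: "1 *\<^sub>C x = x"
    and scaleR_scaleC: "r *\<^sub>R x = complex_of_real r *\<^sub>C x"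
    and cinner_commute: "cinner x y = cnj (cinner y x)"
    and cinner_add_left: "cinner (x + y) z = cinner x z + cinner y z"
    and cinner_scaleC_left: "cinner (a *\<^sub>C x) y = a * cinner x y"
    and inner_eq_Re_cinner: "inner x y = Re (cinner x y)"

class complex_hilbert = complex_inner + complete_space

interpretation complex_vector: vector_space "scaleC :: complex \<Rightarrow> 'a \<Rightarrow> 'a::complex_inner"
  by unfold_locales (fact scaleC_add_right scaleC_add_left scaleC_scaleC scaleC_one)+

text \<open>
  Operators between closed subspaces \<open>H\<close>, \<open>K\<close> of an ambient Hilbert space are represented by
  functions on the ambient space, whose values outside \<open>H\<close> are irrelevant.
\<close>

definition closed_csubspace :: "'a::complex_hilbert set \<Rightarrow> bool" where
  "closed_csubspace H \<longleftrightarrow> complex_vector.subspace H \<and> closed H"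

definition bounded_op :: "'a::complex_hilbert set \<Rightarrow> 'a set \<Rightarrow> ('a \<Rightarrow> 'a) \<Rightarrow> bool" where
  "bounded_op H K A \<longleftrightarrow>
     (\<forall>x\<in>H. A x \<in> K) \<and>
     (\<forall>x\<in>H. \<forall>y\<in>H. A (x + y) = A x + A y) \<and>
     (\<forall>c. \<forall>x\<in>H. A (c *\<^sub>C x) = c *\<^sub>C A x) \<and>
     (\<exists>M. \<forall>x\<in>H. norm (A x) \<le> M * norm x)"

definition op_minus :: "('a::complex_hilbert \<Rightarrow> 'a) \<Rightarrow> complex \<Rightarrow> 'a \<Rightarrow> 'a" where
  "op_minus A w = (\<lambda>x. A x - w *\<^sub>C x)"

definition op_ker :: "'a::complex_hilbert set \<Rightarrow> ('a \<Rightarrow> 'a) \<Rightarrow> 'a set" where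
  "op_ker H A = {x \<in> H. A x = 0}"

definition op_invertible :: "'a::complex_hilbert set \<Rightarrow> ('a \<Rightarrow> 'a) \<Rightarrow> bool" where
  "op_invertible H A \<longleftrightarrow>
     (\<exists>B. bounded_op H H B \<and> (\<forall>x\<in>H. B (A x) = x) \<and> (\<forall>x\<in>H. A (B x) = x))"

definition op_spectrum :: "'a::complex_hilbert set \<Rightarrow> ('a \<Rightarrow> 'a) \<Rightarrow> complex set" where
  "op_spectrum H A = {w. \<not> op_invertible H (op_minus A w)}"

text \<open>
  The library dimension of an infinite-dimensional space is \<open>0\<close>, so the definition below
  is the intended one for positive \<open>n\<close> only.
\<close>

definition cowen_douglas ::
  "nat \<Rightarrow> complex set \<Rightarrow> 'a::complex_hilbert set \<Rightarrow> ('a \<Rightarrow> 'a) set" where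
  "cowen_douglas n \<Omega> H = {A. bounded_op H H A \<and>
     \<Omega> \<subseteq> op_spectrum H A \<and>
     (\<forall>w\<in>\<Omega>. op_minus A w ` H = H) \<and>
     closure (complex_vector.span (\<Union>w\<in>\<Omega>. op_ker H (op_minus A w))) = H \<and>
     (\<forall>w\<in>\<Omega>. complex_vector.dim (op_ker H (op_minus A w)) = n)}"

definition orthogonal_sum :: "nat \<Rightarrow> (nat \<Rightarrow> 'a::complex_hilbert set) \<Rightarrow> bool" where
  "orthogonal_sum n H \<longleftrightarrow>
     (\<forall>i<n. closed_csubspace (H i)) \<and>
     (\<forall>i<n. \<forall>j<n. i \<noteq> j \<longrightarrow> (\<forall>x\<in>H i. \<forall>y\<in>H j. cinner x y = 0)) \<and>
     (\<forall>x. \<exists>h. (\<forall>i<n. h i \<in> H i) \<and> x = (\<Sum>i<n. h i))"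

definition block_matrix ::
  "nat \<Rightarrow> (nat \<Rightarrow> 'a::complex_hilbert set) \<Rightarrow> ('a \<Rightarrow> 'a) \<Rightarrow> (nat \<Rightarrow> nat \<Rightarrow> 'a \<Rightarrow> 'a) \<Rightarrow> bool" where
  "block_matrix n H T S \<longleftrightarrow>
     (\<forall>i<n. \<forall>j<n. bounded_op (H j) (H i) (S i j)) \<and>
     (\<forall>j<n. \<forall>x\<in>H j. T x = (\<Sum>i<n. S i j x))"

text \<open>The diagonal entry \<open>T\<^sub>i\<close> is \<open>S i i\<close>.\<close>

definition FB :: "nat \<Rightarrow> complex set \<Rightarrow> ('a::complex_hilbert \<Rightarrow> 'a) set" where
  "FB n \<Omega> = {T. bounded_op UNIV UNIV T \<and>
     (\<exists>H S. orthogonal_sum n H \<and> block_matrix n H T S \<and>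
        (\<forall>i<n. \<forall>j<i. \<forall>x\<in>H j. S i j x = 0) \<and>
        (\<forall>i<n. S i i \<in> cowen_douglas 1 \<Omega> (H i)) \<and>
        (\<forall>i. i + 1 < n \<longrightarrow>
           (\<exists>x\<in>H (i + 1). S i (i + 1) x \<noteq> 0) \<and>
           (\<forall>x\<in>H (i + 1). S i i (S i (i + 1) x) = S i (i + 1) (S (i + 1) (i + 1) x))))}"

definition orthogonal_projection :: "('a::complex_hilbert \<Rightarrow> 'a) \<Rightarrow> bool" where
  "orthogonal_projection P \<longleftrightarrow>
     bounded_op UNIV UNIV P \<and> P \<circ> P = P \<and> (\<forall>x y. cinner (P x) y = cinner x (P y))"

definition irreducible_op :: "('a::complex_hilbert \<Rightarrow> 'a) \<Rightarrow> bool" where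
  "irreducible_op T \<longleftrightarrow>
     (\<forall>P. orthogonal_projection P \<and> P \<circ> T = T \<circ> P \<longrightarrow> P = (\<lambda>x. 0) \<or> P = id)"

end

theory Submission
  imports Defs "HOL-Complex_Analysis.Conformal_Mappings"
begin

text \<open>
  Let \<open>P\<close> be a projection commuting with \<open>T\<close>, with block matrix \<open>(P i j)\<close>. Working through the
  rows from the bottom and through each row from the left, suppose that the strictly lower
  entries below row \<open>m\<close> and to the left of \<open>P m j\<close>, \<open>j < m\<close>, vanish. As \<open>P\<close> is self-adjoint, the
  entries above the diagonal in the columns beyond \<open>m\<close> vanish as well, so that comparing the
  \<open>(m, j)\<close> and \<open>(m, j + 1)\<close> entries of \<open>P T = T P\<close> gives \<open>P m j T\<^sub>j = T\<^sub>m P m j\<close> and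
  \<open>P m j S j (j+1) = T\<^sub>m P m (j+1) - P m (j+1) T\<^sub>j\<^sub>+\<^sub>1\<close>. Composing the latter with
  \<open>S (j+1) (j+2) \<cdots> S (m-1) m\<close> yields an operator \<open>C\<close> that is a commutator with \<open>T\<^sub>m\<close> and commutes
  with \<open>T\<^sub>m\<close>. By the argument of Kleinecke and Shirokov it annihilates every eigenvector of
  \<open>T\<^sub>m\<close>, so \<open>C = 0\<close>; since non-zero intertwiners of operators in \<open>B\<^sub>1(\<Omega>)\<close> have dense range,
  \<open>P m j = 0\<close>. Hence \<open>P\<close> is diagonal. Its diagonal entries are \<open>0\<close> or \<open>I\<close>, because operators in
  \<open>B\<^sub>1(\<Omega>)\<close> are irreducible, and they all agree because the \<open>S i (i+1)\<close> are non-zero.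
\<close>

section \<open>Complex inner product spaces\<close>

instance complex_hilbert \<subseteq> banach ..

lemma cinner_scaleC_right: "cinner x (a *\<^sub>C y) = cnj a * cinner x (y :: 'a::complex_inner)"
  by (metis cinner_commute cinner_scaleC_left complex_cnj_mult)

lemma norm_scaleC: "norm (a *\<^sub>C x) = cmod a * norm (x :: 'a::complex_inner)"
proof -
  have "Im (cinner x x) = 0"
    using arg_cong[OF cinner_commute[of x x], of Im] by simp
  then have "inner (a *\<^sub>C x) (a *\<^sub>C x) = (cmod a)\<^sup>2 * inner x x"
    unfolding cmod_power2
    by (simp add: inner_eq_Re_cinner cinner_scaleC_left cinner_scaleC_right
        power2_eq_square algebra_simps)
  then show ?thesis
    by (simp add: norm_eq_sqrt_inner real_sqrt_mult)
qed

lemma bounded_linear_scaleC_right: "bounded_linear (\<lambda>x::'a::complex_inner. a *\<^sub>C x)"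
  by (rule bounded_linear_intro[where K = "cmod a"])
    (auto simp: scaleC_add_right scaleR_scaleC scaleC_scaleC norm_scaleC mult.commute)

text \<open>Since Im z = Re (-i z), the complex inner product is recovered from the real one; its
  boundedness in the first argument is then inherited from \<open>inner\<close>.\<close>

lemma cinner_eq_inner:
  "cinner x y = complex_of_real (inner x y) + \<i> * complex_of_real (inner ((-\<i>) *\<^sub>C x) y)"
proof (rule complex_eqI)
  show "Im (cinner x y) = Im (complex_of_real (inner x y) + \<i> * complex_of_real (inner ((-\<i>) *\<^sub>C x) y))"
    by (simp add: inner_eq_Re_cinner cinner_scaleC_left del: complex_vector.scale_minus_left)
qed (simp add: inner_eq_Re_cinner)

lemma bounded_linear_cinner_left: "bounded_linear (\<lambda>x. cinner x (y::'a::complex_inner))"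
proof -
  have *: "bounded_linear (\<lambda>x. complex_of_real (inner (a *\<^sub>C x) y))" for a
    by (intro bounded_linear_compose[OF bounded_linear_of_real, where g = "\<lambda>x. inner (a *\<^sub>C x) y"]
        bounded_linear_compose[OF bounded_linear_inner_left] bounded_linear_scaleC_right)
  show ?thesis
    using bounded_linear_add[OF *[of 1] bounded_linear_compose[OF bounded_linear_mult_right *[of "-\<i>"], of \<i>]]
    by (subst cinner_eq_inner) simp
qed

lemma cinner_diff_left: "cinner (x - y) z = cinner x z - cinner y (z :: 'a::complex_inner)"
  using bounded_linear_cinner_left[of z] by (rule linear_diff[OF bounded_linear.linear])

lemma cinner_sum_left: "cinner (sum f A) y = (\<Sum>i\<in>A. cinner (f i) (y :: 'a::complex_inner))"
  using bounded_linear_cinner_left[of y] by (rule linear_sum[OF bounded_linear.linear])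

lemma cinner_self_eq_0: "cinner x x = 0 \<Longrightarrow> x = (0 :: 'a::complex_inner)"
  by (metis inner_eq_Re_cinner inner_eq_zero_iff zero_complex.simps(1))

lemma csubspace_imp_subspace: "complex_vector.subspace H \<Longrightarrow> subspace H"
  by (simp add: complex_vector.subspace_def subspace_def scaleR_scaleC)

section \<open>Bounded operators between closed subspaces\<close>

lemma bounded_op_in: "bounded_op H K A \<Longrightarrow> x \<in> H \<Longrightarrow> A x \<in> K"
  and bounded_op_add: "bounded_op H K A \<Longrightarrow> x \<in> H \<Longrightarrow> y \<in> H \<Longrightarrow> A (x + y) = A x + A y"
  and bounded_op_scaleC: "bounded_op H K A \<Longrightarrow> x \<in> H \<Longrightarrow> A (c *\<^sub>C x) = c *\<^sub>C A x"
  by (auto simp: bounded_op_def)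

text \<open>The bound is made positive so that radii can later be defined by dividing by it.\<close>

lemma bounded_op_bound:
  assumes "bounded_op H K A"
  obtains M where "M > 0" "\<And>x. x \<in> H \<Longrightarrow> norm (A x) \<le> M * norm x"
proof -
  obtain M where M: "\<And>x. x \<in> H \<Longrightarrow> norm (A x) \<le> M * norm x"
    using assms unfolding bounded_op_def by blast
  have "norm (A x) \<le> max M 1 * norm x" if "x \<in> H" for x
    using M[OF that] by (meson max.cobounded1 mult_right_mono norm_ge_zero order_trans)
  then show ?thesis
    using that[of "max M 1"] by auto
qed

lemma bounded_op_zero:
  assumes "bounded_op H K A" "complex_vector.subspace H"
  shows "A 0 = 0"
  using bounded_op_scaleC[OF assms(1) complex_vector.subspace_0[OF assms(2)], of 0]
  by simp

lemma bounded_op_diff: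
  assumes "bounded_op H K A" "complex_vector.subspace H" "x \<in> H" "y \<in> H"
  shows "A (x - y) = A x - A y"
  using bounded_op_add[OF assms(1) complex_vector.subspace_diff[OF assms(2,3,4)] assms(4)]
  by (simp add: algebra_simps)

lemma bounded_op_sum:
  assumes "bounded_op H K A" "complex_vector.subspace H" "\<And>i. i \<in> I \<Longrightarrow> f i \<in> H"
  shows "A (sum f I) = (\<Sum>i\<in>I. A (f i))"
  using assms(3)
proof (induction I rule: infinite_finite_induct)
  case (insert i I)
  then show ?case
    using bounded_op_add[OF assms(1), of "f i" "sum f I"] complex_vector.subspace_sum[OF assms(2), of I f]
    by simp
qed (use assms bounded_op_zero in auto)

lemma bounded_op_compose:
  assumes "bounded_op H K A" "bounded_op K L B"
  shows "bounded_op H L (\<lambda>x. B (A x))"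
proof -
  obtain M where M: "M > 0" "\<And>x. x \<in> H \<Longrightarrow> norm (A x) \<le> M * norm x"
    using bounded_op_bound[OF assms(1)] by blast
  obtain N where N: "N > 0" "\<And>x. x \<in> K \<Longrightarrow> norm (B x) \<le> N * norm x"
    using bounded_op_bound[OF assms(2)] by blast
  have "norm (B (A x)) \<le> N * M * norm x" if "x \<in> H" for x
  proof -
    have "norm (B (A x)) \<le> N * norm (A x)"
      using N(2) bounded_op_in[OF assms(1) that] by blast
    also have "\<dots> \<le> N * (M * norm x)"
      using M(2)[OF that] N(1) by simp
    finally show ?thesis by (simp add: mult.assoc)
  qed
  then show ?thesis
    using assms unfolding bounded_op_def by metis
qed

lemma bounded_op_subset:
  assumes "bounded_op H K A" "H' \<subseteq> H" "K \<subseteq> K'"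
  shows "bounded_op H' K' A"
proof -
  obtain M where M: "M > 0" "\<And>x. x \<in> H \<Longrightarrow> norm (A x) \<le> M * norm x"
    using bounded_op_bound[OF assms(1)] by blast
  show ?thesis
    unfolding bounded_op_def
  proof (intro conjI ballI allI exI[of _ M])
    fix x y c
    assume "x \<in> H'"
    with assms(2) have x: "x \<in> H" by (rule subsetD)
    show "A x \<in> K'"
      using bounded_op_in[OF assms(1) x] assms(3) by (rule subsetD[rotated])
    show "A (c *\<^sub>C x) = c *\<^sub>C A x" "norm (A x) \<le> M * norm x"
      using bounded_op_scaleC[OF assms(1) x] M(2)[OF x] by auto
    assume "y \<in> H'"
    with assms(2) have "y \<in> H" by (rule subsetD)
    then show "A (x + y) = A x + A y"
      by (rule bounded_op_add[OF assms(1) x])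
  qed
qed

lemma bounded_op_op_minus:
  assumes "bounded_op H H A" "complex_vector.subspace H"
  shows "bounded_op H H (op_minus A w)"
proof -
  obtain M where M: "M > 0" "\<And>x. x \<in> H \<Longrightarrow> norm (A x) \<le> M * norm x"
    using bounded_op_bound[OF assms(1)] by blast
  have "norm (op_minus A w x) \<le> (M + cmod w) * norm x" if "x \<in> H" for x
  proof -
    have "norm (op_minus A w x) \<le> norm (A x) + norm (w *\<^sub>C x)"
      unfolding op_minus_def by (rule norm_triangle_ineq4)
    also have "\<dots> \<le> M * norm x + cmod w * norm x"
      using M(2)[OF that] by (simp add: norm_scaleC)
    finally show ?thesis by (simp add: algebra_simps)
  qed
  moreover have "op_minus A w x \<in> H" if "x \<in> H" for x
    unfolding op_minus_def
    using assms that bounded_op_in complex_vector.subspace_diff complex_vector.subspace_scale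
    by blast
  moreover have "op_minus A w (x + y) = op_minus A w x + op_minus A w y" if "x \<in> H" "y \<in> H" for x y
    using bounded_op_add[OF assms(1) that] by (simp add: op_minus_def scaleC_add_right)
  moreover have "op_minus A w (c *\<^sub>C x) = c *\<^sub>C op_minus A w x" if "x \<in> H" for c x
    using bounded_op_scaleC[OF assms(1) that]
    by (simp add: op_minus_def complex_vector.scale_right_diff_distrib scaleC_scaleC mult.commute)
  ultimately show ?thesis
    unfolding bounded_op_def by blast
qed

text \<open>\<open>A\<close> is linear and bounded on \<open>H\<close> only, so the argument needs
  the partial sums and their distance vector to \<open>s\<close> to lie in \<open>H\<close>.\<close>

lemma bounded_op_sums:
  assumes "bounded_op H K A" "complex_vector.subspace H" "\<And>k. f k \<in> H" "f sums s" "s \<in> H"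
  shows "(\<lambda>k. A (f k)) sums A s"
proof -
  obtain M where M: "M > 0" "\<And>x. x \<in> H \<Longrightarrow> norm (A x) \<le> M * norm x"
    using bounded_op_bound[OF assms(1)] by blast
  have *: "norm ((\<Sum>k<n. A (f k)) - A s) \<le> M * norm ((\<Sum>k<n. f k) - s)" for n
  proof -
    have part: "(\<Sum>k<n. f k) \<in> H"
      by (rule complex_vector.subspace_sum[OF assms(2,3)])
    have "A ((\<Sum>k<n. f k) - s) = (\<Sum>k<n. A (f k)) - A s"
      by (simp only: bounded_op_diff[OF assms(1,2) part assms(5)] bounded_op_sum[OF assms(1,2,3)])
    then show ?thesis
      using M(2)[OF complex_vector.subspace_diff[OF assms(2) part assms(5)]] by simp
  qed
  have "(\<lambda>n. M * norm ((\<Sum>k<n. f k) - s)) \<longlonglongrightarrow> M * norm (s - s)"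
    by (intro tendsto_intros assms(4)[unfolded sums_def])
  then have lim: "(\<lambda>n. M * norm ((\<Sum>k<n. f k) - s)) \<longlonglongrightarrow> 0"
    by simp
  have "(\<lambda>n. (\<Sum>k<n. A (f k)) - A s) \<longlonglongrightarrow> 0"
    using * by (intro Lim_null_comparison[OF always_eventually lim]) blast
  then show ?thesis
    by (simp add: sums_def LIM_zero_iff)
qed

lemma bounded_op_continuous_on:
  assumes "bounded_op H K A" "complex_vector.subspace H"
  shows "continuous_on H A"
proof -
  obtain M where M: "M > 0" "\<And>x. x \<in> H \<Longrightarrow> norm (A x) \<le> M * norm x"
    using bounded_op_bound[OF assms(1)] by blast
  have "dist (A x) (A y) \<le> M * dist x y" if "x \<in> H" "y \<in> H" for x y
    using M(2)[OF complex_vector.subspace_diff[OF assms(2) that]] bounded_op_diff[OF assms that]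
    by (simp add: dist_norm)
  then have "M-lipschitz_on H A"
    using M(1) by (simp add: lipschitz_on_def)
  then show ?thesis
    by (rule lipschitz_on_continuous_on)
qed

text \<open>The zeros of \<open>A\<close> in \<open>H\<close> form a subspace containing
  \<open>G\<close>, hence its span, and continuity on \<open>H\<close> carries the value 0 over to
  the closure.\<close>

lemma bounded_op_eq_0_closure_span:
  assumes "bounded_op H K A" "closed_csubspace H" "closure (complex_vector.span G) = H"
    and "\<And>x. x \<in> G \<Longrightarrow> A x = 0" "x \<in> H"
  shows "A x = 0"
proof -
  have H: "complex_vector.subspace H"
    using assms(2) by (simp add: closed_csubspace_def)
  have sub: "complex_vector.span G \<subseteq> H"
    using assms(3) closure_subset by blast
  have span0: "A y = 0" if "y \<in> complex_vector.span G" for y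
  proof -
    have "complex_vector.subspace {y \<in> H. A y = 0}"
      unfolding complex_vector.subspace_def
      using H bounded_op_zero[OF assms(1) H] bounded_op_add[OF assms(1)]
        bounded_op_scaleC[OF assms(1)]
      by (auto simp: complex_vector.subspace_def)
    moreover have "G \<subseteq> {y \<in> H. A y = 0}"
      using sub assms(4) complex_vector.span_superset by blast
    ultimately show ?thesis
      using complex_vector.span_minimal that by blast
  qed
  have "continuous_on (closure (complex_vector.span G)) A"
    using bounded_op_continuous_on[OF assms(1) H] assms(3) by simp
  then show ?thesis
    using continuous_constant_on_closure[of "complex_vector.span G" A 0 x] span0 assms(3,5) by simp
qed

text \<open>
  The open mapping theorem, by Baire category for the complete space \<open>K\<close> (the theorem \<open>Baire\<close> of
  the library is restricted to Heine-Borel spaces) and successive approximation.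
\<close>

lemma open_mapping_subspace:
  fixes D :: "'a::banach \<Rightarrow> 'b::banach"
  assumes "closed H" "subspace H" "closed K" "subspace K" "D ` H = K"
    and add: "\<And>x y. x \<in> H \<Longrightarrow> y \<in> H \<Longrightarrow> D (x + y) = D x + D y"
    and scale: "\<And>c x. x \<in> H \<Longrightarrow> D (c *\<^sub>R x) = c *\<^sub>R D x"
    and cont: "continuous_on H D"
  shows "\<exists>M>0. \<forall>y\<in>K. \<exists>x\<in>H. D x = y \<and> norm x \<le> M * norm y"
proof -
  have diff: "D (x - y) = D x - D y" if "x \<in> H" "y \<in> H" for x y
    using add[of "x - y" y] that subspace_diff[OF assms(2)] by (simp add: algebra_simps)
  have D0: "D 0 = 0"
    using diff[OF subspace_0[OF assms(2)] subspace_0[OF assms(2)]] by simp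
  \<comment> \<open>By surjectivity these closures cover \<open>K\<close>; Baire category then gives
    one of them an interior point relative to \<open>K\<close>.\<close>
  define C where "C k = closure (D ` (H \<inter> cball 0 (real k)))" for k
  have CK: "C k \<subseteq> K" for k
    unfolding C_def by (rule closure_minimal) (use assms in auto)
  \<comment> \<open>Interiors are to be taken relative to \<open>K\<close>, so \<open>K\<close> is
    treated as a complete metric space of its own.\<close>
  interpret MK: Submetric UNIV dist K
    by unfold_locales auto
  have topK: "MK.sub.mtopology = top_of_set K"
    by (simp add: MK.mtopology_submetric)
  have compK: "MK.sub.mcomplete"
    by (rule MK.closedin_mcomplete_imp_mcomplete) (use assms(3) complete_UNIV in auto)
  have "\<exists>k. MK.sub.mtopology interior_of (C k) \<noteq> {}"
  proof (rule ccontr)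
    assume "\<not> ?thesis"
    then have "MK.sub.mtopology interior_of \<Union>(range C) = {}"
      using CK assms(3)
      by (intro MK.sub.metric_Baire_category_alt[OF compK])
        (auto simp: topK closedin_closed_eq C_def)
    moreover have "\<Union>(range C) = K"
    proof
      show "K \<subseteq> \<Union>(range C)"
      proof
        fix y assume "y \<in> K"
        then obtain x where x: "x \<in> H" "y = D x" using assms(5) by auto
        obtain k where "norm x \<le> real k" using real_arch_simple by blast
        then have "y \<in> D ` (H \<inter> cball 0 (real k))" using x by auto
        then have "y \<in> C k" unfolding C_def by (rule subsetD[OF closure_subset])
        then show "y \<in> \<Union>(range C)" by blast
      qed
    qed (use CK in blast)
    ultimately show False
      using subspace_0[OF assms(4)] interior_of_topspace[of "top_of_set K"] by (auto simp: topK)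
  qed
  then obtain k y0 where "y0 \<in> MK.sub.mtopology interior_of (C k)" by blast
  then obtain U where U: "openin (top_of_set K) U" "y0 \<in> U" "U \<subseteq> C k"
    unfolding topK interior_of_def by blast
  then obtain r where r: "r > 0" "ball y0 r \<inter> K \<subseteq> C k"
    by (meson openin_contains_ball order_trans)
  have y0K: "y0 \<in> K" using U CK by blast
  have near: "\<exists>x. x \<in> H \<and> norm x \<le> real k \<and> dist (D x) u < r / 8" if "u \<in> C k" for u
  proof -
    have "\<exists>v \<in> D ` (H \<inter> cball 0 (real k)). dist v u < r / 8"
      using that[unfolded C_def closure_approachable] r(1) by (meson divide_pos_pos zero_less_numeral)
    then show ?thesis by (auto simp only: Bex_def image_iff Int_iff mem_cball_0)
  qed
  \<comment> \<open>The approximate preimage found below has norm at most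
    \<open>2 * real k / t\<close>, which is \<open>4 * real k / r * norm y\<close>; the added 1
    keeps \<open>M\<close> positive when \<open>k = 0\<close>.\<close>
  define M where "M = (4 * real k + 1) / r"
  have Mpos: "M > 0" using r by (simp add: M_def add_nonneg_pos)
  have approx: "\<exists>x\<in>H. norm x \<le> M * norm y \<and> norm (y - D x) \<le> norm y / 2" if y: "y \<in> K" for y
  proof (cases "y = 0")
    case True
    then show ?thesis
      using subspace_0[OF assms(2)] D0 by (intro bexI[of _ 0]) auto
  next
    case False
    \<comment> \<open>\<open>t\<close> rescales \<open>y\<close> to norm \<open>r / 2\<close>, so
      that \<open>y0 + t *\<^sub>R y\<close> stays in the ball. Subtracting an approximation of
      \<open>y0\<close> moves the centre to the origin, and the two errors \<open>r / 8\<close>,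
      divided by \<open>t\<close>, add up to \<open>norm y / 2\<close>.\<close>
    define t where "t = r / (2 * norm y)"
    have t: "t > 0" using r False by (simp add: t_def)
    have tn: "norm (t *\<^sub>R y) < r" using r False t by (simp add: t_def)
    have "y0 + t *\<^sub>R y \<in> C k"
      using r tn y y0K subspace_add[OF assms(4)] subspace_scale[OF assms(4)]
      by (intro subsetD[OF r(2)]) (auto simp: dist_norm)
    then obtain x1 where x1: "x1 \<in> H" "norm x1 \<le> k" "dist (D x1) (y0 + t *\<^sub>R y) < r / 8"
      using near by blast
    have "y0 \<in> C k"
      using U by blast
    then obtain x2 where x2: "x2 \<in> H" "norm x2 \<le> k" "dist (D x2) y0 < r / 8"
      using near by blast
    define x where "x = (1 / t) *\<^sub>R (x1 - x2)"
    have xH: "x \<in> H"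
      using x1 x2 subspace_diff[OF assms(2)] subspace_scale[OF assms(2)] by (simp add: x_def)
    have Dx: "D x = (1 / t) *\<^sub>R (D x1 - D x2)"
      using x1 x2 scale diff subspace_diff[OF assms(2)] by (simp add: x_def)
    have "norm (t *\<^sub>R y - (D x1 - D x2)) = norm ((D x2 - y0) - (D x1 - (y0 + t *\<^sub>R y)))"
      by (simp add: algebra_simps)
    also have "\<dots> \<le> r / 8 + r / 8"
      using norm_triangle_ineq4[of "D x2 - y0" "D x1 - (y0 + t *\<^sub>R y)"] x1 x2
      by (simp add: dist_norm)
    finally have le: "norm (t *\<^sub>R y - (D x1 - D x2)) \<le> r / 4" by simp
    have "y - D x = (1 / t) *\<^sub>R (t *\<^sub>R y - (D x1 - D x2))"
      using t by (simp add: Dx scaleR_diff_right)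
    then have "norm (y - D x) = (1 / t) * norm (t *\<^sub>R y - (D x1 - D x2))"
      using t by simp
    also have "\<dots> \<le> (1 / t) * (r / 4)"
      using le t by (intro mult_left_mono) auto
    also have "\<dots> = norm y / 2"
      using r False by (simp add: t_def field_simps)
    finally have 1: "norm (y - D x) \<le> norm y / 2" .
    have "norm x = (1 / t) * norm (x1 - x2)"
      using t by (simp add: x_def)
    also have "\<dots> \<le> (1 / t) * (2 * real k)"
      using t x1 x2 norm_triangle_ineq4[of x1 x2] by (intro mult_left_mono) auto
    also have "\<dots> \<le> M * norm y"
      using r False by (simp add: t_def M_def field_simps)
    finally show ?thesis
      using 1 xH by blast
  qed
  define R where "R y = (SOME x. x \<in> H \<and> norm x \<le> M * norm y \<and> norm (y - D x) \<le> norm y / 2)" for y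
  have R: "R y \<in> H" "norm (R y) \<le> M * norm y" "norm (y - D (R y)) \<le> norm y / 2" if "y \<in> K" for y
    using someI_ex[of "\<lambda>x. x \<in> H \<and> norm x \<le> M * norm y \<and> norm (y - D x) \<le> norm y / 2"]
      approx[OF that] unfolding R_def by blast+
  have "\<exists>x\<in>H. D x = y \<and> norm x \<le> 2 * M * norm y" if y: "y \<in> K" for y
  proof -
    \<comment> \<open>\<open>z n\<close> is the residual after \<open>n\<close> approximation steps.
      Its norm at least halves each time, and the corrections \<open>f n\<close> telescope to
      \<open>y - z n\<close> under \<open>D\<close>; their geometric majorant yields the factor
      2.\<close>
    define z where "z n = ((\<lambda>v. v - D (R v)) ^^ n) y" for n
    have z_Suc: "z (Suc n) = z n - D (R (z n))" for n
      by (simp add: z_def)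
    have zK: "z n \<in> K" for n
    proof (induction n)
      case 0
      show ?case using y by (simp add: z_def)
    next
      case (Suc n)
      have "D (R (z n)) \<in> K" using R(1)[OF Suc] assms(5) by blast
      then show ?case unfolding z_Suc using subspace_diff[OF assms(4)] Suc by blast
    qed
    have zn: "norm (z n) \<le> norm y * (1/2) ^ n" for n
    proof (induction n)
      case (Suc n)
      then show ?case using R(3)[OF zK[of n]] by (simp add: z_Suc)
    qed (simp add: z_def)
    define f where "f n = R (z n)" for n
    have fH: "f n \<in> H" for n using R zK by (simp add: f_def)
    have fn: "norm (f n) \<le> M * norm y * (1/2) ^ n" for n
      using order_trans[OF R(2)[OF zK[of n]] mult_left_mono[OF zn[of n], of M]] Mpos
      by (simp add: f_def mult.assoc)
    have geo: "(\<lambda>n. M * norm y * (1/2) ^ n) sums (M * norm y * 2)"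
      using sums_mult[OF geometric_sums[of "1/2::real"], of "M * norm y"] by simp
    have sumf: "summable (\<lambda>n. norm (f n))"
      by (rule summable_comparison_test'[OF sums_summable[OF geo]]) (use fn in auto)
    define s where "s = suminf f"
    have fs: "(\<lambda>n. \<Sum>i<n. f i) \<longlonglongrightarrow> s"
      using sumf summable_norm_cancel summable_sums unfolding s_def sums_def by blast
    have partH: "(\<Sum>i<n. f i) \<in> H" for n
      by (rule subspace_sum[OF assms(2) fH])
    have sH: "s \<in> H"
      by (rule closed_sequentially[OF assms(1) partH fs])
    have Dpart: "D (\<Sum>i<n. f i) = y - z n" for n
    proof (induction n)
      case 0 show ?case by (simp add: D0 z_def)
    next
      case (Suc n)
      then show ?case using add[OF partH fH] by (simp add: z_Suc f_def)
    qed
    have "(\<lambda>n. D (\<Sum>i<n. f i)) \<longlonglongrightarrow> D s"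
      using partH by (intro continuous_on_tendsto_compose[OF cont fs sH]) simp
    moreover have "(\<lambda>n. D (\<Sum>i<n. f i)) \<longlonglongrightarrow> y - 0"
    proof -
      have "(\<lambda>n. norm y * (1/2::real) ^ n) \<longlonglongrightarrow> norm y * 0"
        by (intro tendsto_intros) auto
      then have lim: "(\<lambda>n. norm y * (1/2::real) ^ n) \<longlonglongrightarrow> 0"
        by simp
      have "z \<longlonglongrightarrow> 0"
        using zn by (intro Lim_null_comparison[OF always_eventually lim]) blast
      then show ?thesis
        unfolding Dpart by (rule tendsto_diff[OF tendsto_const])
    qed
    ultimately have "D s = y"
      using LIMSEQ_unique by fastforce
    moreover have "norm s \<le> 2 * M * norm y"
    proof -
      have "norm s \<le> (\<Sum>n. norm (f n))"
        unfolding s_def by (rule summable_norm[OF sumf])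
      also have "\<dots> \<le> M * norm y * 2"
        using suminf_le[OF fn sumf sums_summable[OF geo]] sums_unique[OF geo] by simp
      finally show ?thesis by simp
    qed
    ultimately show ?thesis using sH by blast
  qed
  then show ?thesis
    using Mpos by (intro exI[of _ "2 * M"]) auto
qed

section \<open>Operators in the Cowen-Douglas class of rank one\<close>

lemma op_ker_op_minus: "v \<in> op_ker H (op_minus A w) \<longleftrightarrow> v \<in> H \<and> A v = w *\<^sub>C v"
  by (simp add: op_ker_def op_minus_def)

lemma cowen_douglasD:
  assumes "A \<in> cowen_douglas n \<Omega> H"
  shows "bounded_op H H A"
    and "w \<in> \<Omega> \<Longrightarrow> op_minus A w ` H = H"
    and "closure (complex_vector.span (\<Union>w\<in>\<Omega>. op_ker H (op_minus A w))) = H"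
    and "w \<in> \<Omega> \<Longrightarrow> complex_vector.dim (op_ker H (op_minus A w)) = n"
  using assms by (simp_all add: cowen_douglas_def)

text \<open>The eigenvectors for \<Omega> span a dense subspace. The vanishing results below are
  reduced to eigenvectors by this lemma, directly or by way of the identity theorem.\<close>

lemma cowen_douglas_eq_0:
  assumes "A \<in> cowen_douglas n \<Omega> H" "closed_csubspace H" "bounded_op H K X"
    and "\<And>w v. w \<in> \<Omega> \<Longrightarrow> v \<in> op_ker H (op_minus A w) \<Longrightarrow> X v = 0" "x \<in> H"
  shows "X x = 0"
  using bounded_op_eq_0_closure_span[OF assms(3,2) cowen_douglasD(3)[OF assms(1)] _ assms(5)]
    assms(4) by blast

lemma cowen_douglas_kernel:
  assumes "A \<in> cowen_douglas 1 \<Omega> H" "w \<in> \<Omega>"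
  shows "\<exists>v \<in> op_ker H (op_minus A w). v \<noteq> 0 \<and>
    op_ker H (op_minus A w) \<subseteq> range (\<lambda>c. c *\<^sub>C v)"
proof -
  obtain B where B: "B \<subseteq> op_ker H (op_minus A w)" "complex_vector.independent B"
      "op_ker H (op_minus A w) \<subseteq> complex_vector.span B"
      "card B = complex_vector.dim (op_ker H (op_minus A w))"
    by (rule complex_vector.basis_exists)
  then have "card B = 1"
    using cowen_douglasD(4)[OF assms] by simp
  then obtain v where v: "B = {v}"
    by (rule card_1_singletonE)
  have "v \<noteq> 0"
    using B(2) complex_vector.dependent_zero[of B] unfolding v by auto
  then show ?thesis
    using B(1,3) unfolding v complex_vector.span_singleton by (intro bexI[of _ v]) simp_all
qed

lemma cowen_douglas_kernel_generated:
  assumes "A \<in> cowen_douglas 1 \<Omega> H" "w \<in> \<Omega>"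
    and "v \<in> op_ker H (op_minus A w)" "v \<noteq> 0" "u \<in> op_ker H (op_minus A w)"
  obtains c where "u = c *\<^sub>C v"
proof -
  obtain v0 where v0: "op_ker H (op_minus A w) \<subseteq> range (\<lambda>c. c *\<^sub>C v0)"
    using cowen_douglas_kernel[OF assms(1,2)] by (elim bexE conjE)
  obtain a where a: "v = a *\<^sub>C v0"
    using subsetD[OF v0 assms(3)] by (rule rangeE)
  obtain b where b: "u = b *\<^sub>C v0"
    using subsetD[OF v0 assms(5)] by (rule rangeE)
  have "a \<noteq> 0"
    using assms(4) a by auto
  then have "u = (b / a) *\<^sub>C v"
    by (simp add: a b scaleC_scaleC)
  then show ?thesis ..
qed

section \<open>Local holomorphic sections of the eigenspaces\<close>

text \<open>
  A holomorphic section of the eigenspaces near \<open>w0\<close> is \<open>\<gamma> w = (\<Sum>k. (w - w0) ^ k *\<^sub>C x k)\<close>, where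
  \<open>x 0\<close> is an eigenvector and \<open>x (Suc k)\<close> a preimage of \<open>x k\<close> under \<open>A - w0\<close> whose norm is
  controlled by the open mapping theorem.
\<close>

lemma cowen_douglas_local_section:
  assumes A: "A \<in> cowen_douglas 1 \<Omega> H" and H: "closed_csubspace H"
    and "open \<Omega>" "w0 \<in> \<Omega>"
  obtains r \<gamma> x L where "r > 0" "ball w0 r \<subseteq> \<Omega>" "L > 0" "\<And>k. x k \<in> H"
    and "\<And>w. w \<in> ball w0 r \<Longrightarrow> \<gamma> w \<in> op_ker H (op_minus A w)"
    and "\<And>w. w \<in> ball w0 r \<Longrightarrow> \<gamma> w \<noteq> 0"
    and "\<And>w. w \<in> ball w0 r \<Longrightarrow> (\<lambda>k. (w - w0) ^ k *\<^sub>C x k) sums \<gamma> w"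
    and "\<And>w. w \<in> ball w0 r \<Longrightarrow> norm (\<gamma> w - \<gamma> w0) \<le> L * cmod (w - w0)"
proof -
  define D where "D = op_minus A w0"
  have sub: "complex_vector.subspace H" and clo: "closed H"
    using H by (auto simp: closed_csubspace_def)
  have bD: "bounded_op H H D"
    unfolding D_def by (rule bounded_op_op_minus[OF cowen_douglasD(1)[OF A] sub])
  have "\<exists>M>0. \<forall>y\<in>H. \<exists>x\<in>H. D x = y \<and> norm x \<le> M * norm y"
  proof (rule open_mapping_subspace)
    show "closed H" "closed H" "subspace H" "subspace H"
      using clo csubspace_imp_subspace[OF sub] by auto
    show "D ` H = H"
      unfolding D_def by (rule cowen_douglasD(2)[OF A assms(4)])
    show "continuous_on H D"
      by (rule bounded_op_continuous_on[OF bD sub])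
    show "D (c *\<^sub>R x) = c *\<^sub>R D x" if "x \<in> H" for c x
      unfolding scaleR_scaleC by (rule bounded_op_scaleC[OF bD that])
  qed (rule bounded_op_add[OF bD])
  then obtain M where M: "M > 0" "\<forall>y\<in>H. \<exists>x\<in>H. D x = y \<and> norm x \<le> M * norm y"
    by blast
  then obtain G where G: "\<And>y. y \<in> H \<Longrightarrow> G y \<in> H \<and> D (G y) = y \<and> norm (G y) \<le> M * norm y"
    by metis
  obtain v where v: "v \<in> op_ker H (op_minus A w0)" "v \<noteq> 0"
    using cowen_douglas_kernel[OF A assms(4)] by (elim bexE conjE)
  then have vH: "v \<in> H" and Dv: "D v = 0"
    by (auto simp: op_ker_def D_def)
  define x where "x k = (G ^^ k) v" for k
  have x_0: "x 0 = v" and x_Suc: "x (Suc k) = G (x k)" for k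
    by (auto simp: x_def)
  have xH: "x k \<in> H" for k
    by (induction k) (use vH G in \<open>auto simp: x_0 x_Suc\<close>)
  have Dx: "D (x (Suc k)) = x k" for k
    using G[OF xH[of k]] by (simp add: x_Suc)
  have nx: "norm (x k) \<le> M ^ k * norm v" for k
  proof (induction k)
    case (Suc k)
    have "norm (x (Suc k)) \<le> M * norm (x k)"
      using G[OF xH[of k]] by (simp add: x_Suc)
    also have "\<dots> \<le> M * (M ^ k * norm v)"
      using Suc M(1) by (intro mult_left_mono) auto
    finally show ?case by (simp add: mult.assoc)
  qed (simp add: x_0)
  obtain r0 where r0: "r0 > 0" "ball w0 r0 \<subseteq> \<Omega>"
    using assms(3,4) open_contains_ball by blast
  \<comment> \<open>With \<open>q = M * cmod (w - w0) < 1 / 3\<close> the geometric majorant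
    converges, \<open>1 / (1 - q) - 1 \<le> 2 * q\<close>, and
    \<open>norm (\<gamma> w - v) \<le> 2 * q * norm v < norm v\<close> keeps
    \<open>\<gamma> w\<close> away from 0.\<close>
  define r where "r = min r0 (1 / (3 * M))"
  define t where "t w k = (w - w0) ^ k *\<^sub>C x k" for w k
  define \<gamma> where "\<gamma> w = suminf (t w)" for w
  have tH: "t w k \<in> H" for w k
    unfolding t_def using complex_vector.subspace_scale[OF sub xH] .
  have nt: "norm (t w k) \<le> norm v * (M * cmod (w - w0)) ^ k" for w k
    using mult_left_mono[OF nx[of k], of "cmod (w - w0) ^ k"]
    by (simp add: t_def norm_scaleC norm_power power_mult_distrib mult_ac)
  have q: "M * cmod (w - w0) < 1 / 3" if "w \<in> ball w0 r" for w
    using that M(1) by (simp add: r_def dist_norm norm_minus_commute field_simps)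
  have geo: "(\<lambda>k. norm v * (M * cmod (w - w0)) ^ k) sums (norm v * (1 / (1 - M * cmod (w - w0))))"
    if "w \<in> ball w0 r" for w
    using q[OF that] M(1) by (intro sums_mult geometric_sums) (simp add: abs_mult)
  have sumn: "summable (\<lambda>k. norm (t w k))" if "w \<in> ball w0 r" for w
    by (rule summable_comparison_test'[OF sums_summable[OF geo[OF that]], where N = 0])
      (simp only: real_norm_def abs_norm_cancel nt)
  have sums: "t w sums \<gamma> w" if "w \<in> ball w0 r" for w
    unfolding \<gamma>_def by (rule summable_sums[OF summable_norm_cancel[OF sumn[OF that]]])
  have \<gamma>H: "\<gamma> w \<in> H" if "w \<in> ball w0 r" for w
    using closed_sequentially[OF clo complex_vector.subspace_sum[OF sub tH]
        sums[OF that, unfolded sums_def]] .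
  \<comment> \<open>\<open>D\<close> shifts the series: it kills the term for \<open>k = 0\<close>
    and turns each later one into \<open>w - w0\<close> times its predecessor. Summing gives
    \<open>D (\<gamma> w) = (w - w0) *\<^sub>C \<gamma> w\<close>, that is
    \<open>A (\<gamma> w) = w *\<^sub>C \<gamma> w\<close>.\<close>
  have Dt: "D (t w k) = (case k of 0 \<Rightarrow> 0 | Suc j \<Rightarrow> (w - w0) *\<^sub>C t w j)" for w k
    unfolding t_def bounded_op_scaleC[OF bD xH]
    by (cases k) (simp_all add: x_0 Dv Dx scaleC_scaleC)
  have ker: "\<gamma> w \<in> op_ker H (op_minus A w)" if w: "w \<in> ball w0 r" for w
  proof -
    have "(\<lambda>k. D (t w k)) sums D (\<gamma> w)"
      by (rule bounded_op_sums[OF bD sub tH sums[OF w] \<gamma>H[OF w]])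
    moreover have "(\<lambda>k. D (t w (Suc k))) sums ((w - w0) *\<^sub>C \<gamma> w)"
      unfolding Dt nat.case
      by (rule bounded_linear.sums[OF bounded_linear_scaleC_right sums[OF w]])
    then have "(\<lambda>k. D (t w k)) sums ((w - w0) *\<^sub>C \<gamma> w)"
      by (subst (asm) sums_Suc_iff) (simp add: Dt)
    ultimately have "D (\<gamma> w) = (w - w0) *\<^sub>C \<gamma> w"
      by (rule sums_unique2)
    then show ?thesis
      using \<gamma>H[OF w]
      by (simp add: op_ker_def op_minus_def D_def complex_vector.scale_left_diff_distrib)
  qed
  have bound: "norm (\<gamma> w - v) \<le> 2 * (M * cmod (w - w0)) * norm v" if w: "w \<in> ball w0 r" for w
  proof -
    let ?q = "M * cmod (w - w0)"
    have q0: "0 \<le> ?q" using M(1) by simp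
    have sS: "(\<lambda>k. t w (Suc k)) sums (\<gamma> w - v)"
      using sums[OF w] by (subst sums_Suc_iff) (simp add: t_def x_0)
    have gS: "(\<lambda>k. norm v * ?q ^ Suc k) sums (norm v * (1 / (1 - ?q)) - norm v)"
      using geo[OF w] by (subst sums_Suc_iff) simp
    have "norm (\<gamma> w - v) \<le> norm v * (1 / (1 - ?q)) - norm v"
      unfolding sums_unique[OF sS] sums_unique[OF gS]
      by (rule norm_suminf_le[OF nt sums_summable[OF gS]])
    also have "\<dots> = norm v * (1 / (1 - ?q) - 1)"
      by (simp add: right_diff_distrib)
    also have "\<dots> \<le> norm v * (2 * ?q)"
    proof (rule mult_left_mono)
      have "1 \<le> (1 + 2 * ?q) * (1 - ?q)"
      proof -
        have "?q * (1 - 2 * ?q) \<ge> 0" by (rule mult_nonneg_nonneg[OF q0]) (use q[OF w] in simp)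
        then show ?thesis by (simp add: algebra_simps)
      qed
      then show "1 / (1 - ?q) - 1 \<le> 2 * ?q"
        using q[OF w] pos_divide_le_eq[of "1 - ?q" 1 "1 + 2 * ?q"] by linarith
    qed simp
    finally show ?thesis by (simp add: mult_ac)
  qed
  have "r > 0" using r0 M by (simp add: r_def)
  have \<gamma>0: "\<gamma> w0 = v"
    using bound[of w0] \<open>r > 0\<close> by simp
  show ?thesis
  proof (rule that[of r "2 * M * norm v" x \<gamma>])
    show "ball w0 r \<subseteq> \<Omega>" using r0 by (auto simp: r_def)
    show "\<gamma> w \<noteq> 0" if "w \<in> ball w0 r" for w
    proof
      assume "\<gamma> w = 0"
      then have "norm v \<le> 2 * (M * cmod (w - w0)) * norm v"
        using bound[OF that] by simp
      then have "1 \<le> 2 * (M * cmod (w - w0))"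
        using v(2) by simp
      then show False using q[OF that] by simp
    qed
    show "norm (\<gamma> w - \<gamma> w0) \<le> 2 * M * norm v * cmod (w - w0)" if "w \<in> ball w0 r" for w
      using bound[OF that] by (simp add: \<gamma>0 mult_ac)
    show "0 < 2 * M * norm v" using v(2) M(1) by simp
    show "(\<lambda>k. (w - w0) ^ k *\<^sub>C x k) sums \<gamma> w" if "w \<in> ball w0 r" for w
      using sums[OF that] unfolding t_def .
  qed (fact \<open>r > 0\<close> xH ker)+
qed

section \<open>Spreading vanishing and non-vanishing from one eigenvalue to others\<close>

text \<open>Eigenspaces are lines, so near \<open>w0\<close> all eigenvectors are multiples of the
  local section \<open>\<gamma>\<close>, and \<open>X (\<gamma> w)\<close> stays non-zero by the
  Lipschitz estimate at \<open>w0\<close>.\<close>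

lemma cowen_douglas_nonzero_nhd:
  assumes A: "A \<in> cowen_douglas 1 \<Omega> H" and H: "closed_csubspace H" and "open \<Omega>" "w0 \<in> \<Omega>"
    and X: "bounded_op H K X" and v: "v \<in> op_ker H (op_minus A w0)" "X v \<noteq> 0"
  obtains U where "open U" "U \<noteq> {}" "U \<subseteq> \<Omega>"
    "\<And>w u. w \<in> U \<Longrightarrow> u \<in> op_ker H (op_minus A w) \<Longrightarrow> u \<noteq> 0 \<Longrightarrow> X u \<noteq> 0"
proof -
  have sub: "complex_vector.subspace H"
    using H by (simp add: closed_csubspace_def)
  obtain r \<gamma> L where r: "r > 0" "ball w0 r \<subseteq> \<Omega>" "L > 0"
    and ker: "\<And>w. w \<in> ball w0 r \<Longrightarrow> \<gamma> w \<in> op_ker H (op_minus A w)"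
    and nz: "\<And>w. w \<in> ball w0 r \<Longrightarrow> \<gamma> w \<noteq> 0"
    and bound: "\<And>w. w \<in> ball w0 r \<Longrightarrow> norm (\<gamma> w - \<gamma> w0) \<le> L * cmod (w - w0)"
    by (rule cowen_douglas_local_section[OF A H assms(3,4)]) blast
  obtain N where N: "N > 0" "\<And>x. x \<in> H \<Longrightarrow> norm (X x) \<le> N * norm x"
    using bounded_op_bound[OF X] by blast
  have w0: "w0 \<in> ball w0 r" using r by simp
  have \<gamma>H: "\<gamma> w \<in> H" if "w \<in> ball w0 r" for w
    using ker[OF that] by (simp add: op_ker_def)
  have X0: "X (\<gamma> w0) \<noteq> 0"
  proof
    assume "X (\<gamma> w0) = 0"
    moreover obtain c where "v = c *\<^sub>C \<gamma> w0"
      by (rule cowen_douglas_kernel_generated[OF A assms(4) ker[OF w0] nz[OF w0] v(1)])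
    ultimately show False
      using v(2) bounded_op_scaleC[OF X \<gamma>H[OF w0]] by simp
  qed
  \<comment> \<open>Within this radius \<open>X (\<gamma> w)\<close> differs from
    \<open>X (\<gamma> w0)\<close> by at most \<open>N * L * cmod (w - w0)\<close>, which is less
    than \<open>norm (X (\<gamma> w0))\<close>.\<close>
  define s where "s = min r (norm (X (\<gamma> w0)) / (N * L))"
  have s: "s > 0" using r N X0 by (simp add: s_def)
  show ?thesis
  proof (rule that[of "ball w0 s"])
    show "ball w0 s \<subseteq> \<Omega>" using r by (auto simp: s_def)
    fix w u assume w: "w \<in> ball w0 s" and u: "u \<in> op_ker H (op_minus A w)" "u \<noteq> 0"
    have wr: "w \<in> ball w0 r" using w by (simp add: s_def)
    show "X u \<noteq> 0"
    proof
      assume "X u = 0"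
      moreover obtain c where "\<gamma> w = c *\<^sub>C u"
        by (rule cowen_douglas_kernel_generated[OF A subsetD[OF r(2) wr] u ker[OF wr]])
      ultimately have "X (\<gamma> w) = 0"
        using bounded_op_scaleC[OF X, of u c] u(1) by (simp add: op_ker_def)
      then have "norm (X (\<gamma> w0)) = norm (X (\<gamma> w - \<gamma> w0))"
        using bounded_op_diff[OF X sub \<gamma>H[OF wr] \<gamma>H[OF w0]] by simp
      also have "\<dots> \<le> N * norm (\<gamma> w - \<gamma> w0)"
        by (rule N(2)[OF complex_vector.subspace_diff[OF sub \<gamma>H[OF wr] \<gamma>H[OF w0]]])
      also have "\<dots> \<le> N * (L * cmod (w - w0))"
        using bound[OF wr] N(1) by (intro mult_left_mono) auto
      also have "\<dots> < norm (X (\<gamma> w0))"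
        using w N(1) r(3) by (simp add: s_def dist_norm norm_minus_commute field_simps)
      finally show False by simp
    qed
  qed (use s in auto)
qed

text \<open>The identity theorem, applied to \<open>w \<mapsto> \<langle>X (\<gamma> w), y\<rangle>\<close> for local sections \<open>\<gamma>\<close>.\<close>

lemma cowen_douglas_identity:
  assumes A: "A \<in> cowen_douglas 1 \<Omega> H" and H: "closed_csubspace H"
    and \<Omega>: "open \<Omega>" "connected \<Omega>" and U: "open U" "U \<noteq> {}" "U \<subseteq> \<Omega>"
    and X: "bounded_op H K X"
    and zero: "\<And>w v. w \<in> U \<Longrightarrow> v \<in> op_ker H (op_minus A w) \<Longrightarrow> X v = 0"
    and "x \<in> H"
  shows "X x = 0"
proof (rule cowen_douglas_eq_0[OF A H X _ \<open>x \<in> H\<close>])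
  have sub: "complex_vector.subspace H"
    using H by (simp add: closed_csubspace_def)
  define Z where "Z w \<longleftrightarrow> (\<forall>v \<in> op_ker H (op_minus A w). X v = 0)" for w
  \<comment> \<open>\<open>P\<close> asks for vanishing near \<open>w\<close>, not only at
    \<open>w\<close>. By \<open>step\<close> this property is locally constant on \<Omega>, so
    connectedness spreads it.\<close>
  define P where "P w \<longleftrightarrow> (\<exists>V. open V \<and> w \<in> V \<and> (\<forall>w'\<in>V. Z w'))" for w
  have step: "\<exists>T. openin (top_of_set \<Omega>) T \<and> w0 \<in> T \<and> (\<forall>w\<in>T. \<forall>w'\<in>T. P w \<longrightarrow> P w')"
    if w0: "w0 \<in> \<Omega>" for w0
  proof -
    obtain r \<gamma> xs where r: "r > 0" "ball w0 r \<subseteq> \<Omega>"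
      and xs: "\<And>k. xs k \<in> H"
      and ker: "\<And>w. w \<in> ball w0 r \<Longrightarrow> \<gamma> w \<in> op_ker H (op_minus A w)"
      and nz: "\<And>w. w \<in> ball w0 r \<Longrightarrow> \<gamma> w \<noteq> 0"
      and sums: "\<And>w. w \<in> ball w0 r \<Longrightarrow> (\<lambda>k. (w - w0) ^ k *\<^sub>C xs k) sums \<gamma> w"
      by (rule cowen_douglas_local_section[OF A H \<Omega>(1) w0]) blast
    have \<gamma>H: "\<gamma> w \<in> H" if "w \<in> ball w0 r" for w
      using ker[OF that] by (simp add: op_ker_def)
    have hol: "(\<lambda>w. cinner (X (\<gamma> w)) y) holomorphic_on ball w0 r" for y
    proof (rule power_series_holomorphic)
      fix w assume w: "w \<in> ball w0 r"
      have "(\<lambda>k. X ((w - w0) ^ k *\<^sub>C xs k)) sums X (\<gamma> w)"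
        by (rule bounded_op_sums[OF X sub complex_vector.subspace_scale[OF sub xs] sums[OF w] \<gamma>H[OF w]])
      then have "(\<lambda>k. cinner (X ((w - w0) ^ k *\<^sub>C xs k)) y) sums cinner (X (\<gamma> w)) y"
        by (rule bounded_linear.sums[OF bounded_linear_cinner_left])
      then show "(\<lambda>k. cinner (X (xs k)) y * (w - w0) ^ k) sums cinner (X (\<gamma> w)) y"
        by (simp add: bounded_op_scaleC[OF X xs] cinner_scaleC_left mult.commute)
    qed
    have "P w'" if w: "w \<in> ball w0 r" "w' \<in> ball w0 r" "P w" for w w'
    proof -
      obtain V where V: "open V" "w \<in> V" "\<forall>w'\<in>V. Z w'"
        using \<open>P w\<close> unfolding P_def by blast
      have X0: "X (\<gamma> z) = 0" if z: "z \<in> ball w0 r" for z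
      proof -
        \<comment> \<open>Testing against the fixed vector \<open>X (\<gamma> z)\<close> gives a
          scalar holomorphic function that vanishes on \<open>V \<inter> ball w0 r\<close>; its
          value at \<open>z\<close> is a squared norm.\<close>
        have "cinner (X (\<gamma> z)) (X (\<gamma> z)) = 0"
        proof (rule analytic_continuation_open[where s = "V \<inter> ball w0 r" and s' = "ball w0 r"
              and f = "\<lambda>w. cinner (X (\<gamma> w)) (X (\<gamma> z))" and g = "\<lambda>w. 0"])
          show "V \<inter> ball w0 r \<noteq> {}" using V w by blast
          show "cinner (X (\<gamma> u)) (X (\<gamma> z)) = 0" if "u \<in> V \<inter> ball w0 r" for u
          proof -
            have "X (\<gamma> u) = 0"
              using that V(3) ker unfolding Z_def by blast
            then show ?thesis
              using cinner_diff_left[of 0 0 "X (\<gamma> z)"] by simp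
          qed
        qed (use V(1) hol z in auto)
        then show ?thesis by (rule cinner_self_eq_0)
      qed
      have "Z z" if z: "z \<in> ball w0 r" for z
        unfolding Z_def
      proof
        fix u assume "u \<in> op_ker H (op_minus A z)"
        then obtain c where "u = c *\<^sub>C \<gamma> z"
          by (rule cowen_douglas_kernel_generated[OF A subsetD[OF r(2) z] ker[OF z] nz[OF z]])
        then show "X u = 0"
          using bounded_op_scaleC[OF X \<gamma>H[OF z]] X0[OF z] by simp
      qed
      then show ?thesis
        unfolding P_def using w(2) by (intro exI[of _ "ball w0 r"]) blast
    qed
    moreover have "openin (top_of_set \<Omega>) (ball w0 r)" "w0 \<in> ball w0 r"
      using r by (simp_all add: open_subset)
    ultimately show ?thesis by blast
  qed
  obtain w1 where w1: "w1 \<in> U" using U(2) by blast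
  have "P w1"
    unfolding P_def Z_def using zero by (intro exI[of _ U] conjI U w1) blast
  have "P w" if "w \<in> \<Omega>" for w
    by (rule connected_induction_simple[OF \<Omega>(2) subsetD[OF U(3) w1] that \<open>P w1\<close> step])
  then show "X v = 0" if "w \<in> \<Omega>" "v \<in> op_ker H (op_minus A w)" for w v
    using that unfolding P_def Z_def by blast
qed

text \<open>Density of the range of \<open>S\<close>, in the form of right cancellation.
  \<open>S\<close> is non-zero on some eigenvector, hence on all of them over an open set
  \<open>U\<close>. Over \<open>U\<close> it carries eigenvectors of \<open>B\<close> to generators
  of the eigenlines of \<open>A\<close>, where \<open>Y\<close> therefore vanishes, and the identity
  theorem applies.\<close>

lemma cowen_douglas_intertwiner_epi:
  assumes A: "A \<in> cowen_douglas 1 \<Omega> H" and H: "closed_csubspace H"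
    and B: "B \<in> cowen_douglas 1 \<Omega> K" and K: "closed_csubspace K"
    and \<Omega>: "open \<Omega>" "connected \<Omega>"
    and S: "bounded_op K H S" "\<And>x. x \<in> K \<Longrightarrow> A (S x) = S (B x)" "\<exists>x\<in>K. S x \<noteq> 0"
    and Y: "bounded_op H L Y" "\<And>x. x \<in> K \<Longrightarrow> Y (S x) = 0" and "x \<in> H"
  shows "Y x = 0"
proof -
  obtain w0 v where w0: "w0 \<in> \<Omega>" and v: "v \<in> op_ker K (op_minus B w0)" "S v \<noteq> 0"
    using cowen_douglas_eq_0[OF B K S(1)] S(3) by metis
  obtain U where U: "open U" "U \<noteq> {}" "U \<subseteq> \<Omega>"
    and nz: "\<And>w u. w \<in> U \<Longrightarrow> u \<in> op_ker K (op_minus B w) \<Longrightarrow> u \<noteq> 0 \<Longrightarrow> S u \<noteq> 0"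
    by (rule cowen_douglas_nonzero_nhd[OF B K \<Omega>(1) w0 S(1) v]) blast
  show ?thesis
  proof (rule cowen_douglas_identity[OF A H \<Omega> U Y(1) _ \<open>x \<in> H\<close>])
    fix w y assume w: "w \<in> U" and y: "y \<in> op_ker H (op_minus A w)"
    have w\<Omega>: "w \<in> \<Omega>" using w U(3) by (rule subsetD[rotated])
    obtain u where u: "u \<in> op_ker K (op_minus B w)" "u \<noteq> 0"
      using cowen_douglas_kernel[OF B w\<Omega>] by (elim bexE conjE)
    then have uK: "u \<in> K" "B u = w *\<^sub>C u"
      by (simp_all add: op_ker_op_minus)
    have "S u \<in> op_ker H (op_minus A w)"
      unfolding op_ker_op_minus
      using bounded_op_in[OF S(1) uK(1)] S(2)[OF uK(1)] bounded_op_scaleC[OF S(1) uK(1)] uK(2)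
      by simp
    then obtain c where "y = c *\<^sub>C S u"
      by (rule cowen_douglas_kernel_generated[OF A w\<Omega> _ nz[OF w u] y])
    then show "Y y = 0"
      using bounded_op_scaleC[OF Y(1) bounded_op_in[OF S(1) uK(1)]] Y(2)[OF uK(1)] by simp
  qed
qed

section \<open>Idempotents commuting with an operator in \<open>cowen_douglas 1\<close>\<close>

text \<open>As \<open>P - 1\<close> maps \<open>v\<close> to \<open>-v\<close>, it is non-zero on
  all non-zero eigenvectors over an open set. But it annihilates \<open>P u\<close>, again an
  eigenvector or 0, so \<open>P u = 0\<close> over that set.\<close>

lemma cowen_douglas_idempotent_eq_0:
  assumes A: "A \<in> cowen_douglas 1 \<Omega> H" and H: "closed_csubspace H"
    and \<Omega>: "open \<Omega>" "connected \<Omega>"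
    and P: "bounded_op H H P" "\<And>x. x \<in> H \<Longrightarrow> P (P x) = P x" "\<And>x. x \<in> H \<Longrightarrow> A (P x) = P (A x)"
    and v: "w0 \<in> \<Omega>" "v \<in> op_ker H (op_minus A w0)" "v \<noteq> 0" "P v = 0" and "x \<in> H"
  shows "P x = 0"
proof -
  have sub: "complex_vector.subspace H"
    using H by (simp add: closed_csubspace_def)
  have bQ: "bounded_op H H (op_minus P 1)"
    by (rule bounded_op_op_minus[OF P(1) sub])
  have Qv: "op_minus P 1 v \<noteq> 0"
    using v by (simp add: op_minus_def)
  obtain U where U: "open U" "U \<noteq> {}" "U \<subseteq> \<Omega>"
    and nz: "\<And>w u. w \<in> U \<Longrightarrow> u \<in> op_ker H (op_minus A w) \<Longrightarrow> u \<noteq> 0 \<Longrightarrow> op_minus P 1 u \<noteq> 0"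
    by (rule cowen_douglas_nonzero_nhd[OF A H \<Omega>(1) v(1) bQ v(2) Qv]) blast
  show ?thesis
  proof (rule cowen_douglas_identity[OF A H \<Omega> U P(1) _ \<open>x \<in> H\<close>])
    fix w u assume w: "w \<in> U" and u: "u \<in> op_ker H (op_minus A w)"
    have uH: "u \<in> H" "A u = w *\<^sub>C u"
      using u by (simp_all add: op_ker_op_minus)
    have Pu: "P u \<in> op_ker H (op_minus A w)"
      unfolding op_ker_op_minus
      using bounded_op_in[OF P(1) uH(1)] P(3)[OF uH(1)] bounded_op_scaleC[OF P(1) uH(1)] uH(2)
      by simp
    show "P u = 0"
    proof (rule ccontr)
      assume "P u \<noteq> 0"
      then have "op_minus P 1 (P u) \<noteq> 0"
        by (rule nz[OF w Pu])
      then show False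
        using P(2)[OF uH(1)] by (simp add: op_minus_def)
    qed
  qed
qed

lemma cowen_douglas_idempotent_trivial:
  assumes A: "A \<in> cowen_douglas 1 \<Omega> H" and H: "closed_csubspace H"
    and \<Omega>: "open \<Omega>" "connected \<Omega>"
    and P: "bounded_op H H P" "\<And>x. x \<in> H \<Longrightarrow> P (P x) = P x" "\<And>x. x \<in> H \<Longrightarrow> A (P x) = P (A x)"
  shows "(\<forall>x\<in>H. P x = 0) \<or> (\<forall>x\<in>H. P x = x)"
proof (cases "\<Omega> = {}")
  case True
  \<comment> \<open>Density of an empty family of eigenvectors leaves only the zero space.\<close>
  then have "P x = 0" if "x \<in> H" for x
    using cowen_douglas_eq_0[OF A H P(1) _ that] by simp
  then show ?thesis by simp
next
  case False
  then obtain w0 where w0: "w0 \<in> \<Omega>" by blast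
  obtain v where v: "v \<in> op_ker H (op_minus A w0)" "v \<noteq> 0"
    using cowen_douglas_kernel[OF A w0] by (elim bexE conjE)
  then have vH: "v \<in> H" "A v = w0 *\<^sub>C v"
    by (simp_all add: op_ker_op_minus)
  have sub: "complex_vector.subspace H"
    using H by (simp add: closed_csubspace_def)
  define Q where "Q x = x - P x" for x
  \<comment> \<open>Writing \<open>1 - P\<close> through \<open>op_minus\<close> reduces its
    boundedness to that of shifts and compositions.\<close>
  have Q_def': "Q = (\<lambda>x. op_minus (\<lambda>x. 0) 1 (op_minus P 1 x))"
    by (simp add: Q_def op_minus_def fun_eq_iff)
  have zero: "bounded_op H H (\<lambda>x. 0)"
    unfolding bounded_op_def using complex_vector.subspace_0[OF sub]
    by (intro conjI ballI allI exI[of _ 0]) simp_all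
  have bQ: "bounded_op H H Q"
    unfolding Q_def'
    by (rule bounded_op_compose[OF bounded_op_op_minus[OF P(1) sub] bounded_op_op_minus[OF zero sub]])
  have QQ: "Q (Q x) = Q x" if "x \<in> H" for x
    using bounded_op_diff[OF P(1) sub that bounded_op_in[OF P(1) that]] P(2)[OF that]
    by (simp add: Q_def)
  have AQ: "A (Q x) = Q (A x)" if "x \<in> H" for x
    using bounded_op_diff[OF cowen_douglasD(1)[OF A] sub that bounded_op_in[OF P(1) that]] P(3)[OF that]
    by (simp add: Q_def)
  have PvH: "P v \<in> H"
    by (rule bounded_op_in[OF P(1) vH(1)])
  have Pv: "P v \<in> op_ker H (op_minus A w0)"
    using PvH P(3)[OF vH(1)] vH(2) bounded_op_scaleC[OF P(1) vH(1)]
    by (simp add: op_ker_op_minus)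
  show ?thesis
  proof (cases "P v = 0")
    case True
    then show ?thesis
      using cowen_douglas_idempotent_eq_0[OF A H \<Omega> P w0 v] by blast
  next
    case False
    \<comment> \<open>\<open>P v\<close> is a non-zero eigenvector annihilated by the complementary
      idempotent, to which the preceding lemma applies in turn.\<close>
    have "Q (P v) = 0"
      using P(2)[OF vH(1)] by (simp add: Q_def)
    then have "Q x = 0" if "x \<in> H" for x
      using cowen_douglas_idempotent_eq_0[OF A H \<Omega> bQ QQ AQ w0 Pv False] that by blast
    then show ?thesis by (simp add: Q_def)
  qed
qed

section \<open>The Kleinecke-Shirokov argument\<close>

text \<open>
  The bracket with \<open>D\<close> is a derivation that maps \<open>B\<close> to \<open>C\<close> and \<open>C\<close> to \<open>0\<close>, so \<open>D ^^ k\<close> acts on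
  \<open>B ^^ k\<close> like a \<open>k\<close>-th derivative.
\<close>

lemma commutator_power_eigenvector:
  fixes D B C :: "'a::complex_hilbert \<Rightarrow> 'a"
  assumes sub: "complex_vector.subspace H"
    and D: "bounded_op H H D" and B: "bounded_op H H B" and C: "bounded_op H H C"
    and DB: "\<And>x. x \<in> H \<Longrightarrow> D (B x) = B (D x) + C x"
    and DC: "\<And>x. x \<in> H \<Longrightarrow> D (C x) = C (D x)"
    and v: "v \<in> H" "D v = 0" "C v = c *\<^sub>C v"
  shows "(D ^^ k) ((B ^^ k) v) = (fact k * c ^ k) *\<^sub>C v"
proof -
  have Dn: "(D ^^ n) x \<in> H" if "x \<in> H" for n x
    by (induction n) (use that bounded_op_in[OF D] in auto)
  have D_scale: "D (a *\<^sub>C x) = a *\<^sub>C D x" if "x \<in> H" for a x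
    by (rule bounded_op_scaleC[OF D that])
  have B0: "B 0 = 0"
    by (rule bounded_op_zero[OF B sub])
  have DBn: "(D ^^ Suc n) (B x) = B ((D ^^ Suc n) x) + of_nat (Suc n) *\<^sub>C C ((D ^^ n) x)"
    if x: "x \<in> H" for n x
  proof (induction n)
    case 0
    then show ?case using DB[OF x] by (simp add: scaleC_one)
  next
    case (Suc n)
    let ?y = "(D ^^ Suc n) x"
    have CH: "C ((D ^^ n) x) \<in> H"
      by (rule bounded_op_in[OF C Dn[OF x]])
    have "(D ^^ Suc (Suc n)) (B x) = D (B ?y + of_nat (Suc n) *\<^sub>C C ((D ^^ n) x))"
      using Suc by simp
    also have "\<dots> = D (B ?y) + of_nat (Suc n) *\<^sub>C D (C ((D ^^ n) x))"
      unfolding D_scale[OF CH, symmetric]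
      by (rule bounded_op_add[OF D bounded_op_in[OF B Dn[OF x]]
            complex_vector.subspace_scale[OF sub CH]])
    also have "\<dots> = B (D ?y) + (C ?y + of_nat (Suc n) *\<^sub>C C ?y)"
      using DB[OF Dn[OF x, of "Suc n"]] DC[OF Dn[OF x, of n]] by simp
    also have "C ?y + of_nat (Suc n) *\<^sub>C C ?y = of_nat (Suc (Suc n)) *\<^sub>C C ?y"
      using scaleC_add_left[of 1 "of_nat (Suc n)" "C ?y"] by (simp add: scaleC_one)
    finally show ?case by simp
  qed
  have BH: "(B ^^ k) v \<in> H" for k
    by (induction k) (use v bounded_op_in[OF B] in auto)
  show ?thesis
  proof (induction k)
    case 0
    then show ?case by (simp add: scaleC_one)
  next
    case (Suc k)
    \<comment> \<open>By induction \<open>(D ^^ k) ((B ^^ k) v)\<close> is a multiple of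
      \<open>v\<close>, which one more \<open>D\<close> kills. So only the commutator term of
      \<open>DBn\<close> survives, contributing the factor
      \<open>of_nat (Suc k) * c\<close>.\<close>
    have "(D ^^ Suc k) ((B ^^ k) v) = 0"
      using Suc D_scale[OF v(1)] v(2) by simp
    then have "(D ^^ Suc k) ((B ^^ Suc k) v) = of_nat (Suc k) *\<^sub>C C ((D ^^ k) ((B ^^ k) v))"
      using DBn[OF BH[of k], of k] B0 by simp
    also have "\<dots> = of_nat (Suc k) *\<^sub>C ((fact k * c ^ k) *\<^sub>C c *\<^sub>C v)"
      using Suc bounded_op_scaleC[OF C v(1)] v(3) by simp
    also have "\<dots> = (fact (Suc k) * c ^ Suc k) *\<^sub>C v"
      by (simp add: scaleC_scaleC mult_ac)
    finally show ?case .
  qed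
qed

text \<open>
  For \<open>D = A - w\<close> and an eigenvector \<open>u\<close> with \<open>C u = c *\<^sub>C u\<close>, the preceding identity gives
  \<open>k! \<bar>c\<bar>^k \<le> (\<parallel>D\<parallel> \<parallel>B\<parallel>)^k\<close> for all \<open>k\<close>, which forces \<open>c = 0\<close>.
\<close>

lemma cowen_douglas_commutator_eq_0:
  assumes A: "A \<in> cowen_douglas 1 \<Omega> H" and H: "closed_csubspace H"
    and B: "bounded_op H H B" and C: "bounded_op H H C"
    and AB: "\<And>x. x \<in> H \<Longrightarrow> A (B x) = B (A x) + C x"
    and AC: "\<And>x. x \<in> H \<Longrightarrow> A (C x) = C (A x)" and "x \<in> H"
  shows "C x = 0"
proof (rule cowen_douglas_eq_0[OF A H C _ \<open>x \<in> H\<close>])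
  fix w u assume w: "w \<in> \<Omega>" and u: "u \<in> op_ker H (op_minus A w)"
  have sub: "complex_vector.subspace H"
    using H by (simp add: closed_csubspace_def)
  have bA: "bounded_op H H A"
    by (rule cowen_douglasD(1)[OF A])
  define D where "D = op_minus A w"
  have D: "bounded_op H H D"
    unfolding D_def by (rule bounded_op_op_minus[OF bA sub])
  have uH: "u \<in> H" "A u = w *\<^sub>C u" "D u = 0"
    using u by (auto simp: op_ker_def op_minus_def D_def)
  show "C u = 0"
  proof (cases "u = 0")
    case True
    then show ?thesis using bounded_op_zero[OF C sub] by simp
  next
    case False
    \<comment> \<open>\<open>C\<close> preserves this eigenspace because it commutes with
      \<open>A\<close>; on a line it can only act by a scalar.\<close>
    have "C u \<in> op_ker H (op_minus A w)"
      using bounded_op_in[OF C uH(1)] AC[OF uH(1)] uH(2) bounded_op_scaleC[OF C uH(1)]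
      by (simp add: op_ker_op_minus)
    then obtain c where c: "C u = c *\<^sub>C u"
      by (rule cowen_douglas_kernel_generated[OF A w u False])
    have DB: "D (B y) = B (D y) + C y" if y: "y \<in> H" for y
      using AB[OF y] bounded_op_scaleC[OF B y]
        bounded_op_diff[OF B sub bounded_op_in[OF bA y] complex_vector.subspace_scale[OF sub y]]
      by (simp add: D_def op_minus_def)
    have DC: "D (C y) = C (D y)" if y: "y \<in> H" for y
      using AC[OF y] bounded_op_scaleC[OF C y]
        bounded_op_diff[OF C sub bounded_op_in[OF bA y] complex_vector.subspace_scale[OF sub y]]
      by (simp add: D_def op_minus_def)
    obtain M where M: "M > 0" "\<And>x. x \<in> H \<Longrightarrow> norm (D x) \<le> M * norm x"
      using bounded_op_bound[OF D] by blast
    obtain N where N: "N > 0" "\<And>x. x \<in> H \<Longrightarrow> norm (B x) \<le> N * norm x"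
      using bounded_op_bound[OF B] by blast
    have powbound: "(F ^^ k) y \<in> H \<and> norm ((F ^^ k) y) \<le> K ^ k * norm y"
      if F: "bounded_op H H F" and K: "K > 0" "\<And>x. x \<in> H \<Longrightarrow> norm (F x) \<le> K * norm x"
        and y: "y \<in> H" for F K k y
    proof (induction k)
      case (Suc k)
      have "norm (F ((F ^^ k) y)) \<le> K * norm ((F ^^ k) y)"
        by (rule K(2)) (use Suc in simp)
      also have "\<dots> \<le> K * (K ^ k * norm y)"
        by (rule mult_left_mono) (use Suc K(1) in simp_all)
      finally show ?case
        using bounded_op_in[OF F] Suc by (simp add: mult.assoc)
    qed (use y in simp)
    have le: "cmod c ^ k \<le> (M * N) ^ k / fact k" for k
    proof -
      have "norm ((D ^^ k) ((B ^^ k) u)) \<le> M ^ k * norm ((B ^^ k) u)"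
        using powbound[OF D M] powbound[OF B N uH(1)] by simp
      also have "\<dots> \<le> M ^ k * (N ^ k * norm u)"
        by (rule mult_left_mono) (use powbound[OF B N uH(1)] M(1) in simp_all)
      also have "(D ^^ k) ((B ^^ k) u) = (fact k * c ^ k) *\<^sub>C u"
        by (rule commutator_power_eigenvector[OF sub D B C _ _ uH(1,3) c]) (fact DB DC)+
      finally have "fact k * cmod c ^ k * norm u \<le> (M * N) ^ k * norm u"
        by (simp add: norm_scaleC norm_mult norm_power power_mult_distrib mult_ac)
      then show ?thesis
        using False by (simp add: field_simps)
    qed
    have "cmod c = 0"
    proof (rule ccontr)
      assume "cmod c \<noteq> 0"
      \<comment> \<open>Dividing the estimate by \<open>cmod c ^ k\<close> bounds
        \<open>R ^ k / fact k\<close> below by 1, although these are terms of a convergent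
        exponential series.\<close>
      define R where "R = M * N / cmod c"
      have "(\<lambda>k. R ^ k / fact k) \<longlonglongrightarrow> 0"
        using summable_LIMSEQ_zero[OF summable_exp[of R]] by (simp add: field_simps)
      moreover have "1 \<le> R ^ k / fact k" for k
        using le[of k] \<open>cmod c \<noteq> 0\<close> by (simp add: R_def power_divide field_simps)
      ultimately show False
        using LIMSEQ_le_const[of "\<lambda>k. R ^ k / fact k" 0 1] by auto
    qed
    then show ?thesis using c by simp
  qed
qed

section \<open>Projections commuting with an operator of flag type\<close>

text \<open>The choice does not depend on \<open>i\<close>, so all components of \<open>x\<close>
  come from one decomposition; orthogonality makes that decomposition unique.\<close>

definition component :: "nat \<Rightarrow> (nat \<Rightarrow> 'a::complex_hilbert set) \<Rightarrow> nat \<Rightarrow> 'a \<Rightarrow> 'a" where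
  "component n H i x = (SOME h. (\<forall>i<n. h i \<in> H i) \<and> x = (\<Sum>i<n. h i)) i"

context
  fixes n :: nat and H :: "nat \<Rightarrow> 'a::complex_hilbert set"
  assumes sum: "orthogonal_sum n H"
begin

lemma orthogonal_sum_closed: "i < n \<Longrightarrow> closed_csubspace (H i)"
  using sum by (simp add: orthogonal_sum_def)

lemma orthogonal_sum_subspace: "i < n \<Longrightarrow> complex_vector.subspace (H i)"
  using orthogonal_sum_closed by (simp add: closed_csubspace_def)

lemma orthogonal_sum_orthogonal:
  "i < n \<Longrightarrow> j < n \<Longrightarrow> i \<noteq> j \<Longrightarrow> x \<in> H i \<Longrightarrow> y \<in> H j \<Longrightarrow> cinner x y = 0"
  using sum by (simp add: orthogonal_sum_def)

lemma component_in_and_sum: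
  "(\<forall>i<n. component n H i x \<in> H i) \<and> x = (\<Sum>i<n. component n H i x)"
proof -
  have "\<exists>h. (\<forall>i<n. h i \<in> H i) \<and> x = (\<Sum>i<n. h i)"
    using sum by (simp add: orthogonal_sum_def)
  then show ?thesis
    unfolding component_def by (rule someI_ex)
qed

lemma component_in: "i < n \<Longrightarrow> component n H i x \<in> H i"
  using component_in_and_sum by simp

lemma component_sum: "(\<Sum>i<n. component n H i x) = x"
  using component_in_and_sum[of x] by simp

lemma cinner_sum_orthogonal:
  assumes "i < n" "y \<in> H i" "\<And>j. j < n \<Longrightarrow> h j \<in> H j"
  shows "cinner (\<Sum>j<n. h j) y = cinner (h i) y"
proof -
  have "cinner (\<Sum>j<n. h j) y = (\<Sum>j<n. if j = i then cinner (h i) y else 0)"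
    unfolding cinner_sum_left using orthogonal_sum_orthogonal assms by (intro sum.cong) auto
  then show ?thesis using assms(1) by simp
qed

lemma cinner_component:
  "i < n \<Longrightarrow> y \<in> H i \<Longrightarrow> cinner (component n H i x) y = cinner x y"
  using cinner_sum_orthogonal[of i y "\<lambda>j. component n H j x"] component_in
  by (simp add: component_sum)

text \<open>The difference of the two candidates lies in \<open>H i\<close> and is orthogonal to
  \<open>H i\<close>, hence to itself. Uniqueness and linearity of components rest on this
  criterion.\<close>

lemma component_eqI:
  assumes "i < n" "a \<in> H i" "\<And>y. y \<in> H i \<Longrightarrow> cinner x y = cinner a y"
  shows "component n H i x = a"
proof -
  let ?d = "component n H i x - a"
  have "?d \<in> H i"
    by (rule complex_vector.subspace_diff[OF orthogonal_sum_subspace component_in])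
      (use assms in simp_all)
  then have "cinner ?d ?d = 0"
    unfolding cinner_diff_left using assms(3) cinner_component[OF assms(1)] by simp
  then show ?thesis
    using cinner_self_eq_0[of ?d] by simp
qed

lemma component_of_sum:
  "i < n \<Longrightarrow> (\<And>j. j < n \<Longrightarrow> h j \<in> H j) \<Longrightarrow> component n H i (\<Sum>j<n. h j) = h i"
  by (rule component_eqI) (simp_all add: cinner_sum_orthogonal)

lemma bounded_op_component:
  assumes "i < n"
  shows "bounded_op UNIV (H i) (component n H i)"
  unfolding bounded_op_def
proof (intro conjI ballI allI exI[of _ 1])
  fix x y c
  show "component n H i x \<in> H i"
    by (rule component_in[OF assms])
  show "component n H i (x + y) = component n H i x + component n H i y"
    by (rule component_eqI[OF assms complex_vector.subspace_add[OF orthogonal_sum_subspace[OF assms]]])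
      (simp_all add: component_in cinner_add_left cinner_component assms)
  show "component n H i (c *\<^sub>C x) = c *\<^sub>C component n H i x"
    by (rule component_eqI[OF assms complex_vector.subspace_scale[OF orthogonal_sum_subspace[OF assms]]])
      (simp_all add: component_in cinner_scaleC_left cinner_component assms)
  let ?e = "component n H i x"
  have "norm ?e * norm ?e = inner ?e ?e"
    by (metis power2_eq_square power2_norm_eq_inner)
  also have "\<dots> = inner x ?e"
    unfolding inner_eq_Re_cinner cinner_component[OF assms component_in[OF assms]] ..
  also have "\<dots> \<le> norm x * norm ?e"
    by (rule norm_cauchy_schwarz)
  finally show "norm ?e \<le> 1 * norm x"
    by (cases "norm ?e = 0") auto
qed

end

section \<open>The block matrix of a projection commuting with the operator\<close>

locale FB_projection =
  fixes n :: nat and \<Omega> :: "complex set" and H :: "nat \<Rightarrow> 'a::complex_hilbert set"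
    and S :: "nat \<Rightarrow> nat \<Rightarrow> 'a \<Rightarrow> 'a" and T P :: "'a \<Rightarrow> 'a"
  assumes open_connected: "open \<Omega>" "connected \<Omega>"
    and T: "bounded_op UNIV UNIV T"
    and ortho: "orthogonal_sum n H"
    and block: "block_matrix n H T S"
    and triangular: "\<And>i j x. i < n \<Longrightarrow> j < i \<Longrightarrow> x \<in> H j \<Longrightarrow> S i j x = 0"
    and diagonal: "\<And>i. i < n \<Longrightarrow> S i i \<in> cowen_douglas 1 \<Omega> (H i)"
    and superdiagonal_nonzero: "\<And>i. Suc i < n \<Longrightarrow> \<exists>x\<in>H (Suc i). S i (Suc i) x \<noteq> 0"
    and superdiagonal_intertwines: "\<And>i x. Suc i < n \<Longrightarrow> x \<in> H (Suc i) \<Longrightarrow>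
      S i i (S i (Suc i) x) = S i (Suc i) (S (Suc i) (Suc i) x)"
    and projection: "orthogonal_projection P"
    and commute: "\<And>x. P (T x) = T (P x)"
begin

lemmas subspaceH = orthogonal_sum_subspace[OF ortho]
  and closedH = orthogonal_sum_closed[OF ortho]

lemma bounded_S: "i < n \<Longrightarrow> j < n \<Longrightarrow> bounded_op (H j) (H i) (S i j)"
  using block by (simp add: block_matrix_def)

lemma S_in: "i < n \<Longrightarrow> j < n \<Longrightarrow> x \<in> H j \<Longrightarrow> S i j x \<in> H i"
  by (rule bounded_op_in[OF bounded_S])

lemma S_0: "i < n \<Longrightarrow> j < n \<Longrightarrow> S i j 0 = 0"
  by (rule bounded_op_zero[OF bounded_S subspaceH])

lemma bounded_P: "bounded_op UNIV UNIV P"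
  using projection by (simp add: orthogonal_projection_def)

lemma P_P: "P (P x) = P x"
  using projection by (simp add: orthogonal_projection_def fun_eq_iff)

lemma P_selfadjoint: "cinner (P x) y = cinner x (P y)"
  using projection by (simp add: orthogonal_projection_def)

text \<open>Restricted to \<open>H j\<close>, \<open>p i\<close> is the \<open>(i, j)\<close> entry of the block matrix of \<open>P\<close>.\<close>

definition p :: "nat \<Rightarrow> 'a \<Rightarrow> 'a" where
  "p i x = component n H i (P x)"

lemma bounded_p_UNIV: "i < n \<Longrightarrow> bounded_op UNIV (H i) (p i)"
  unfolding p_def[abs_def] by (rule bounded_op_compose[OF bounded_P bounded_op_component[OF ortho]])

lemma bounded_p: "i < n \<Longrightarrow> bounded_op (H j) (H i) (p i)"
  by (rule bounded_op_subset[OF bounded_p_UNIV]) simp_all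

lemma p_in: "i < n \<Longrightarrow> p i x \<in> H i"
  using bounded_op_in[OF bounded_p_UNIV] by simp

lemma p_0: "i < n \<Longrightarrow> p i 0 = 0"
  by (rule bounded_op_zero[OF bounded_p_UNIV complex_vector.subspace_UNIV])

lemma P_eq_sum: "P x = (\<Sum>i<n. p i x)"
  unfolding p_def by (rule component_sum[OF ortho, symmetric])

text \<open>This is the \<open>(m, j)\<close> entry of \<open>P T = T P\<close>, obtained by taking
  the component in \<open>H m\<close> of both sides at \<open>x\<close>.\<close>

lemma block_commute:
  assumes "m < n" "j < n" "x \<in> H j"
  shows "(\<Sum>i<n. p m (S i j x)) = (\<Sum>i<n. S m i (p i x))"
proof -
  note U = complex_vector.subspace_UNIV
  have Tblock: "T y = (\<Sum>i<n. S i k y)" if "k < n" "y \<in> H k" for k y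
    using block that by (simp add: block_matrix_def)
  have comp: "component n H m (T y) = S m k y" if "k < n" "y \<in> H k" for k y
    unfolding Tblock[OF that]
    by (rule component_of_sum[OF ortho assms(1)]) (rule S_in[OF _ that])
  have "p m (T x) = (\<Sum>i<n. p m (S i j x))"
    unfolding Tblock[OF assms(2,3)] by (rule bounded_op_sum[OF bounded_p_UNIV[OF assms(1)] U UNIV_I])
  moreover have "p m (T x) = component n H m (T (\<Sum>i<n. p i x))"
    by (simp add: p_def[of m] commute flip: P_eq_sum)
  moreover have "\<dots> = (\<Sum>i<n. component n H m (T (p i x)))"
    unfolding bounded_op_sum[OF T U UNIV_I]
    by (rule bounded_op_sum[OF bounded_op_component[OF ortho assms(1)] U UNIV_I])
  moreover have "\<dots> = (\<Sum>i<n. S m i (p i x))"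
    by (rule sum.cong) (simp_all add: comp p_in)
  ultimately show ?thesis by simp
qed

text \<open>The \<open>(j, i)\<close> entry of the self-adjoint \<open>P\<close> is the adjoint of
  the \<open>(i, j)\<close> entry; explicitly, the squared norm of \<open>p j x\<close> is the inner
  product of \<open>x\<close> with \<open>p i (p j x)\<close>.\<close>

lemma p_adjoint_0:
  assumes "i < n" "j < n" "\<And>x. x \<in> H j \<Longrightarrow> p i x = 0" "x \<in> H i"
  shows "p j x = 0"
proof -
  have "cinner (p j x) (p j x) = cinner (P x) (p j x)"
    unfolding p_def using cinner_component[OF ortho assms(2) component_in[OF ortho assms(2)]] .
  also have "\<dots> = cinner x (P (p j x))"
    by (rule P_selfadjoint)
  also have "\<dots> = cnj (cinner (p i (p j x)) x)"
    unfolding p_def[of i] cinner_component[OF ortho assms(1,4)] by (rule cinner_commute)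
  also have "\<dots> = 0"
    using assms(3)[OF p_in[OF assms(2)]] cinner_diff_left[of 0 0 x] by simp
  finally show ?thesis by (rule cinner_self_eq_0)
qed

section \<open>Vanishing of the strictly lower entries of the projection\<close>

lemma epi_superdiagonal:
  assumes "Suc i < n" "bounded_op (H i) K Y" "\<And>x. x \<in> H (Suc i) \<Longrightarrow> Y (S i (Suc i) x) = 0"
    and "x \<in> H i"
  shows "Y x = 0"
proof -
  have i: "i < n" using assms(1) by simp
  show ?thesis
    by (rule cowen_douglas_intertwiner_epi[OF diagonal[OF i] closedH[OF i]
          diagonal[OF assms(1)] closedH[OF assms(1)] open_connected bounded_S[OF i assms(1)] _
          superdiagonal_nonzero[OF assms(1)] assms(2) _ assms(4)])
      (fact superdiagonal_intertwines[OF assms(1)] assms(3))+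
qed

text \<open>\<open>R\<close> is the composition of \<open>S j (j+1), \<dots>, S (m-1) m\<close>.\<close>

lemma superdiagonal_chain:
  assumes "j \<le> m" "m < n"
  shows "\<exists>R. bounded_op (H m) (H j) R \<and> (\<forall>x\<in>H m. S j j (R x) = R (S m m x)) \<and>
    (\<forall>Y. bounded_op (H j) (H m) Y \<longrightarrow> (\<forall>x\<in>H m. Y (R x) = 0) \<longrightarrow> (\<forall>x\<in>H j. Y x = 0))"
  using assms(1)
proof (induction rule: inc_induct)
  case base
  \<comment> \<open>For \<open>j = m\<close> the composition is empty.\<close>
  have "bounded_op (H m) (H m) (\<lambda>x. x)"
    unfolding bounded_op_def by (intro conjI ballI allI exI[of _ 1]) simp_all
  then show ?case by (intro exI[of _ "\<lambda>x. x"]) simp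
next
  case (step j)
  then have j: "Suc j < n" using assms(2) by simp
  obtain R where R: "bounded_op (H m) (H (Suc j)) R"
      "\<forall>x\<in>H m. S (Suc j) (Suc j) (R x) = R (S m m x)"
    and epi: "\<forall>Y. bounded_op (H (Suc j)) (H m) Y \<longrightarrow> (\<forall>x\<in>H m. Y (R x) = 0) \<longrightarrow>
        (\<forall>x\<in>H (Suc j). Y x = 0)"
    using step.IH by (elim exE conjE)
  have bS: "bounded_op (H (Suc j)) (H j) (S j (Suc j))"
    using bounded_S j by simp
  show ?case
  proof (intro exI[of _ "\<lambda>x. S j (Suc j) (R x)"] conjI allI ballI impI)
    show "bounded_op (H m) (H j) (\<lambda>x. S j (Suc j) (R x))"
      by (rule bounded_op_compose[OF R(1) bS])
    show "S j j (S j (Suc j) (R x)) = S j (Suc j) (R (S m m x))" if "x \<in> H m" for x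
      using superdiagonal_intertwines[OF j bounded_op_in[OF R(1) that]] R(2) that by simp
    fix Y x
    assume Y: "bounded_op (H j) (H m) Y" "\<forall>x\<in>H m. Y (S j (Suc j) (R x)) = 0" and x: "x \<in> H j"
    \<comment> \<open>Cancellation goes one factor at a time: first the shorter chain
      \<open>R\<close> is removed on the right, then \<open>S j (Suc j)\<close>.\<close>
    have "\<forall>x\<in>H (Suc j). Y (S j (Suc j) x) = 0"
      using epi[rule_format, OF bounded_op_compose[OF bS Y(1)]] Y(2) by simp
    then show "Y x = 0"
      using epi_superdiagonal[OF j Y(1) _ x] by simp
  qed
qed

lemma p_strictly_lower_0:
  assumes "m < n" "j < m" "x \<in> H j"
  shows "p m x = 0"
  using assms
\<comment> \<open>The measure \<open>n - m\<close> makes the outer induction climb from the bottom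
  row; the inner one on \<open>j\<close> runs through a row from the left.\<close>
proof (induction "n - m" arbitrary: m j x rule: less_induct)
  case (less m)
  note m = \<open>m < n\<close>
  have below: "p i x = 0" if "m < i" "i < n" "l \<le> m" "x \<in> H l" for i l x
    by (rule less.hyps) (use that m in auto)
  show ?case
    using less.prems(2,3)
  proof (induction j arbitrary: x rule: less_induct)
    case (less j)
    then have j: "Suc j \<le> m" "Suc j < n" "j < n"
      using m by simp_all
    \<comment> \<open>The \<open>(m, l)\<close> entry of the commutation. On the side of
      \<open>S m i\<close> the terms with \<open>i < m\<close> vanish by triangularity and those
      with \<open>i > m\<close> by \<open>below\<close>. On the other side triangularity removes
      \<open>i > l\<close> and the inner induction hypothesis removes \<open>i < j\<close>. Only
      \<open>l = j\<close> and \<open>l = Suc j\<close> are used, leaving one and two terms.\<close>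
    have row: "S m m (p m y) = (\<Sum>i\<in>{j..l}. p m (S i l y))" if l: "j \<le> l" "l \<le> m" and y: "y \<in> H l" for l y
    proof -
      have ln: "l < n" using l m by simp
      have "(\<Sum>i<n. S m i (p i y)) = (\<Sum>i<n. if i = m then S m m (p m y) else 0)"
      proof (rule sum.cong)
        fix i assume "i \<in> {..<n}"
        then have i: "i < n" by simp
        show "S m i (p i y) = (if i = m then S m m (p m y) else 0)"
        proof (cases i m rule: linorder_cases)
          case less
          then show ?thesis using triangular[OF m less p_in[OF i]] by simp
        next
          case greater
          then show ?thesis using below[OF greater i l(2) y] S_0[OF m i] by simp
        qed simp
      qed simp
      moreover have "(\<Sum>i<n. p m (S i l y)) = (\<Sum>i\<in>{j..l}. p m (S i l y))"
      proof (rule sum.mono_neutral_right)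
        show "\<forall>i\<in>{..<n} - {j..l}. p m (S i l y) = 0"
        proof
          fix i assume "i \<in> {..<n} - {j..l}"
          then consider "i < j" "i < n" | "l < i" "i < n" by fastforce
          then show "p m (S i l y) = 0"
          proof cases
            case 1
            then show ?thesis
              using less.IH[OF 1(1) _ S_in[OF 1(2) ln y]] less.prems(1) by simp
          next
            case 2
            then show ?thesis using triangular[OF 2(2,1) y] p_0[OF m] by simp
          qed
        qed
      qed (use ln in auto)
      ultimately show ?thesis
        using block_commute[OF m ln y] m by simp
    qed
    have row_j: "S m m (p m y) = p m (S j j y)" if "y \<in> H j" for y
      using row[of j y] that j by simp
    have row_Suc: "S m m (p m y) = p m (S j (Suc j) y) + p m (S (Suc j) (Suc j) y)"
      if "y \<in> H (Suc j)" for y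
      using row[of "Suc j" y] that j by simp
    obtain R where R: "bounded_op (H m) (H (Suc j)) R"
        "\<forall>x\<in>H m. S (Suc j) (Suc j) (R x) = R (S m m x)"
      and epi: "\<forall>Y. bounded_op (H (Suc j)) (H m) Y \<longrightarrow> (\<forall>x\<in>H m. Y (R x) = 0) \<longrightarrow>
          (\<forall>x\<in>H (Suc j). Y x = 0)"
      using superdiagonal_chain[OF j(1) m] by (elim exE conjE)
    have bS: "bounded_op (H (Suc j)) (H j) (S j (Suc j))"
      by (rule bounded_S[OF j(3,2)])
    have Y: "bounded_op (H (Suc j)) (H m) (\<lambda>x. p m (S j (Suc j) x))"
      by (rule bounded_op_compose[OF bS bounded_p[OF m]])
    \<comment> \<open>Precomposing with \<open>R\<close> turns \<open>row_Suc\<close> into the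
      statement that \<open>C\<close> is the commutator of \<open>S m m\<close> with
      \<open>B\<close>, and \<open>row_j\<close> into the statement that \<open>C\<close> commutes
      with \<open>S m m\<close>.\<close>
    have "p m (S j (Suc j) (R y)) = 0" if "y \<in> H m" for y
    proof (rule cowen_douglas_commutator_eq_0[where A = "S m m" and H = "H m"
          and B = "\<lambda>x. p m (R x)" and C = "\<lambda>x. p m (S j (Suc j) (R x))"])
      show "bounded_op (H m) (H m) (\<lambda>x. p m (R x))"
        by (rule bounded_op_compose[OF R(1) bounded_p[OF m]])
      show "bounded_op (H m) (H m) (\<lambda>x. p m (S j (Suc j) (R x)))"
        by (rule bounded_op_compose[OF R(1) Y])
      fix z assume z: "z \<in> H m"
      note Rz = bounded_op_in[OF R(1) z]
      show "S m m (p m (R z)) = p m (R (S m m z)) + p m (S j (Suc j) (R z))"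
        using row_Suc[OF Rz] R(2) z by simp
      show "S m m (p m (S j (Suc j) (R z))) = p m (S j (Suc j) (R (S m m z)))"
        using row_j[OF bounded_op_in[OF bS Rz]] superdiagonal_intertwines[OF j(2) Rz] R(2) z
        by simp
    qed (fact diagonal[OF m] closedH[OF m] that)+
    \<comment> \<open>Both intertwiners are now cancelled: \<open>R\<close> here, and
      \<open>S j (Suc j)\<close> in the last step.\<close>
    then have "\<forall>y\<in>H (Suc j). p m (S j (Suc j) y) = 0"
      using epi[rule_format, OF Y] by simp
    then show ?case
      using epi_superdiagonal[OF j(2) bounded_p[OF m] _ less.prems(2)] by simp
  qed
qed

section \<open>Diagonality and triviality of the projection\<close>

lemma p_off_diagonal_0:
  assumes "i < n" "j < n" "i \<noteq> j" "x \<in> H j"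
  shows "p i x = 0"
proof (cases "j < i")
  case True
  then show ?thesis by (rule p_strictly_lower_0[OF assms(1) _ assms(4)])
next
  case False
  then have "i < j" using assms(3) by simp
  then show ?thesis
    using p_adjoint_0[OF assms(2,1) p_strictly_lower_0[OF assms(2)] assms(4)] by simp
qed

lemma P_diagonal:
  assumes "j < n" "x \<in> H j"
  shows "P x = p j x"
proof -
  have "P x = (\<Sum>i<n. p i x)"
    by (rule P_eq_sum)
  also have "\<dots> = (\<Sum>i<n. if i = j then p j x else 0)"
  proof (rule sum.cong)
    fix i assume "i \<in> {..<n}"
    then show "p i x = (if i = j then p j x else 0)"
      using p_off_diagonal_0[OF _ assms(1) _ assms(2), of i] by (cases "i = j") simp_all
  qed (rule refl)
  also have "\<dots> = p j x"
    using assms(1) by simp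
  finally show ?thesis .
qed

lemma P_in: "j < n \<Longrightarrow> x \<in> H j \<Longrightarrow> P x \<in> H j"
  using P_diagonal[of j x] p_in[of j x] by simp

text \<open>As \<open>P\<close> is diagonal, each sum in \<open>block_commute\<close> has a single
  surviving term. The case \<open>i = j\<close> makes \<open>P\<close> commute with the diagonal
  entries; the case \<open>j = Suc i\<close> links neighbouring summands.\<close>

lemma P_S:
  assumes "i < n" "j < n" "x \<in> H j"
  shows "P (S i j x) = S i j (P x)"
proof -
  have "p i (S i j x) = (\<Sum>k<n. if k = i then p i (S i j x) else 0)"
    using assms(1) by simp
  also have "\<dots> = (\<Sum>k<n. p i (S k j x))"
  proof (rule sum.cong)
    fix k assume "k \<in> {..<n}"
    then show "(if k = i then p i (S i j x) else 0) = p i (S k j x)"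
      using p_off_diagonal_0[OF assms(1) _ _ S_in[OF _ assms(2,3)], of k] by simp
  qed simp
  also have "\<dots> = (\<Sum>k<n. S i k (p k x))"
    by (rule block_commute[OF assms])
  also have "\<dots> = (\<Sum>k<n. if k = j then S i j (p j x) else 0)"
  proof (rule sum.cong)
    fix k assume "k \<in> {..<n}"
    then show "S i k (p k x) = (if k = j then S i j (p j x) else 0)"
      using p_off_diagonal_0[OF _ assms(2) _ assms(3), of k] S_0[OF assms(1), of k] by simp
  qed simp
  also have "\<dots> = S i j (p j x)"
    using assms(2) by simp
  finally show ?thesis
    unfolding P_diagonal[OF assms(1) S_in[OF assms]] P_diagonal[OF assms(2,3)] .
qed

lemma P_on_summand:
  assumes "j < n"
  shows "(\<forall>x\<in>H j. P x = 0) \<or> (\<forall>x\<in>H j. P x = x)"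
proof (rule cowen_douglas_idempotent_trivial[OF diagonal[OF assms] closedH[OF assms] open_connected])
  show "bounded_op (H j) (H j) P"
    using bounded_op_subset[OF bounded_P, of "H j" UNIV] P_in[OF assms] unfolding bounded_op_def by simp
qed (simp_all add: P_P P_S assms)

lemma P_trivial: "P = (\<lambda>x. 0) \<or> P = id"
proof (cases "n = 0")
  case True
  then show ?thesis using P_eq_sum by (simp add: fun_eq_iff)
next
  case False
  have P_components: "P x = (\<Sum>i<n. P (component n H i x))" for x
    using bounded_op_sum[OF bounded_P complex_vector.subspace_UNIV UNIV_I,
        of "\<lambda>i. component n H i x" "{..<n}"]
    by (simp add: component_sum[OF ortho])
  consider "\<forall>x\<in>H 0. P x = 0" | "\<forall>x\<in>H 0. P x = x"
    using P_on_summand[of 0] False by auto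
  then show ?thesis
  proof cases
    case 1
    have "\<forall>x\<in>H i. P x = 0" if "i < n" for i
      using that
    proof (induction i)
      case (Suc i)
      obtain x where x: "x \<in> H (Suc i)" "S i (Suc i) x \<noteq> 0"
        using superdiagonal_nonzero[OF Suc.prems] by blast
      have i: "i < n" using Suc.prems by simp
      \<comment> \<open>\<open>P\<close> is 0 or the identity on \<open>H (Suc i)\<close>; the
        vector \<open>x\<close> with non-zero image under \<open>S i (Suc i)\<close> rules out the
        identity.\<close>
      have "S i (Suc i) (P x) = 0"
        using P_S[OF i Suc.prems x(1)] Suc.IH[OF i] S_in[OF i Suc.prems x(1)] by simp
      then have "P x \<noteq> x" using x(2) by auto
      then show ?case using P_on_summand[OF Suc.prems] x(1) by blast
    qed (use 1 in simp)
    then have "P x = 0" for x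
      unfolding P_components[of x] using component_in[OF ortho] by (intro sum.neutral) simp
    then show ?thesis by (simp add: fun_eq_iff)
  next
    case 2
    have "\<forall>x\<in>H i. P x = x" if "i < n" for i
      using that
    proof (induction i)
      case (Suc i)
      obtain x where x: "x \<in> H (Suc i)" "S i (Suc i) x \<noteq> 0"
        using superdiagonal_nonzero[OF Suc.prems] by blast
      have i: "i < n" using Suc.prems by simp
      \<comment> \<open>Here the same vector rules out that \<open>P\<close> is 0 on
        \<open>H (Suc i)\<close>.\<close>
      have "S i (Suc i) (P x) \<noteq> 0"
        using P_S[OF i Suc.prems x(1)] Suc.IH[OF i] S_in[OF i Suc.prems x(1)] x(2) by simp
      then have "P x \<noteq> 0" using S_0[OF i Suc.prems] by auto
      then show ?case using P_on_summand[OF Suc.prems] x(1) by blast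
    qed (use 2 in simp)
    then have "P x = x" for x
      unfolding P_components[of x] using component_in[OF ortho] component_sum[OF ortho, of x] by simp
    then show ?thesis by (simp add: fun_eq_iff)
  qed
qed

end

theorem proposition3p7:
  fixes \<Omega> :: "complex set" and n :: nat and T :: "'a::complex_hilbert \<Rightarrow> 'a"
  assumes "separable_space (euclidean :: 'a topology)"
    and "open \<Omega>" and "connected \<Omega>" and "n \<ge> 1"
    and "T \<in> FB n \<Omega>"
  shows "irreducible_op T"
  unfolding irreducible_op_def
proof (intro allI impI)
  fix P :: "'a \<Rightarrow> 'a"
  assume P: "orthogonal_projection P \<and> P \<circ> T = T \<circ> P"
  obtain H S where "bounded_op UNIV UNIV T" "orthogonal_sum n H" "block_matrix n H T S"
    "\<forall>i<n. \<forall>j<i. \<forall>x\<in>H j. S i j x = 0"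
    "\<forall>i<n. S i i \<in> cowen_douglas 1 \<Omega> (H i)"
    "\<forall>i. i + 1 < n \<longrightarrow>
       (\<exists>x\<in>H (i + 1). S i (i + 1) x \<noteq> 0) \<and>
       (\<forall>x\<in>H (i + 1). S i i (S i (i + 1) x) = S i (i + 1) (S (i + 1) (i + 1) x))"
    using assms(5) unfolding FB_def mem_Collect_eq by (elim conjE exE)
  then interpret FB_projection n \<Omega> H S T P
    using assms(2,3) P by unfold_locales (simp_all add: fun_eq_iff)
  show "P = (\<lambda>x. 0) \<or> P = id"
    by (rule P_trivial)
qed

end
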